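(* Let $d=2$ or $d=3$, and consider on $\mathbb{R}^d$ the inertial Qian–Sheng system (notation in the context) for a velocity $v$, a pressure $p$ and a $Q$-tensor field $Q$: $$\dot v+\nabla p-\tfrac{\beta_4}{2}\Delta v=\nabla\cdot\Big(-L\nabla Q\odot\nabla Q+\beta_1 Q\,\mathrm{tr}(QA)+\beta_5 AQ+\beta_6 QA\Big)+\nabla\cdot\Big(\tfrac{\mu_2}{2}(\dot Q-[\Omega,Q])+\mu_1\big[Q,(\dot Q-[\Omega,Q])\big]\Big),$$ $$\nabla\cdot v=0,$$ $$J\ddot Q+\mu_1\dot Q=L\Delta Q-aQ+b\big(Q^2-\tfrac1d|Q|^2I_d\big)-cQ|Q|^2+\tfrac{\tilde\mu_2}{2}A+\mu_1[\Omega,Q].$$ Assume that $\beta_1,\beta_4,\mu_1\ge 0$, that $J>0$ and $L>0$, that $\beta_6-\beta_5=\mu_2$ and $\beta_5+\beta_6=0$, that $\tilde\mu_2\in\{\mu_2,-\mu_2\}$ and, if $\tilde\mu_2=\mu_2$, then $\tilde\mu_2=\mu_2=0$, and that $c>0$. Then there exists a constant $C_d$ depending on $\tilde\mu_2,\beta_5,\beta_6,\mu_2$ such that, if $\beta_4>C_d$, then for classical solutions that decay fast enough at infinity the total energy decays, i.e. $$\frac{d}{dt}\int_{\mathbb{R}^d}\frac12\big(|v|^2+J|\dot Q|^2+L|\nabla Q|^2\big)+\psi_B(Q)\,dx\le 0 .$$ Furthermore: (i) If $d=2$ and $a\ge 0$, then $\psi_B(Q)\ge 0$ and for any $T>0$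 one has the a priori bounds $$v\in L^\infty(0,T;L^2(\mathbb{R}^d))\cap L^2(0,T;H^1(\mathbb{R}^d)),\qquad Q\in L^\infty(0,T;H^1(\mathbb{R}^d)),\qquad \dot Q\in L^\infty(0,T;L^2(\mathbb{R}^d)).\quad(\ast)$$ (ii) If $d=2$ and $a<0$, or if $d=3$ (and $a$ is arbitrary), then $\psi_B(Q)$ can be negative. In this case there exist $\bar\mu_1=\bar\mu_1(a,b,c)$, $J_0=J_0(\bar\mu_1,a,b,c)$ and $\tilde C_d=\tilde C_d(\tilde\mu_2,\beta_5,\beta_6,\mu_2)>0$ such that if $J<J_0$, $\mu_1>\bar\mu_1$ and $\beta_4>\tilde C_d$, then the a priori bounds $(\ast)$ hold.
   Context: The unknowns are $v:\mathbb{R}_+\times\mathbb{R}^d\to\mathbb{R}^d$, $p:\mathbb{R}_+\times\mathbb{R}^d\to\mathbb{R}$ and $Q:\mathbb{R}_+\times\mathbb{R}^d\to S_0^{(d)}$, where $S_0^{(d)}:=\{Q\in\mathbb{R}^{d\times d}: Q_{ij}=Q_{ji},\ \mathrm{tr}(Q)=0,\ i,j=1,\dots,d\}$. The coefficients $J,L,a,b,c,\beta_1,\beta_4,\beta_5,\beta_6,\mu_1,\mu_2,\tilde\mu_2$ are real constants. Notation: $\dot f=(\partial_t+v\cdot\nabla)f$ is the material derivative and $\ddot f$ is the material derivative applied twice; a subscript $_{,j}$ denotes $\partial/\partial x_j$; $A_{ij}=\frac12(v_{i,j}+v_{j,i})$; $\Omega_{ij}=\frac12(v_{i,j}-v_{j,i})$;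 $[M,N]=MN-NM$ for $d\times d$ matrices; $(\nabla Q\odot\nabla Q)_{ij}=\sum_{k,l=1}^d Q_{kl,i}Q_{kl,j}$; $|Q|=\sqrt{\mathrm{tr}(Q^2)}$; $|\nabla Q|^2=\sum_{i,j,k}Q_{ij,k}^2$; $I_d$ is the $d\times d$ identity matrix; for a matrix field $M$, $(\nabla\cdot M)_i=\sum_j M_{ij,j}$. The bulk potential is $\psi_B(Q)=\frac a2\mathrm{tr}(Q^2)-\frac b3\mathrm{tr}(Q^3)+\frac c4(\mathrm{tr}(Q^2))^2$. "Decay fast enough at infinity" means sufficiently fast that one can integrate by parts over $\mathbb{R}^d$ without boundary terms after testing the momentum equation with $v$ and the $Q$-equation with $\dot Q$ (and with $Q$); this happens for instance if the solutions are in the function spaces listed in $(\ast)$. The a priori bounds are bounds for such classical solutions.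
   Formalization: In the energy decay and in (i), C_d may also depend on μ1, and the case μ1=0, μ2≠0 is excluded (decay fails there for Q=0, Q̇=−sA initially); for d=3, "ψ_B(Q) can be negative" means: for each a and c>0 there are b and Q with ψ_B(Q)<0. *)

theory Defs
  imports "HOL-Analysis.Analysis"
begin

text \<open>
  Space is \<open>real ^ 'n\<close> with \<open>d = CARD('n)\<close>, and \<open>M $ i $ j\<close> is the entry \<open>M_ij\<close>.  Fields on
  \<open>[0,\<infinity>) \<times> R^d\<close> are curried functions of time and space whose values at negative times are
  irrelevant; accordingly time derivatives are taken within \<open>{0..}\<close> (one-sided at \<open>t = 0\<close>).
\<close>

definition dx :: "'n::finite \<Rightarrow> (real^'n \<Rightarrow> 'b::real_normed_vector) \<Rightarrow> real^'n \<Rightarrow> 'b" where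
  "dx j f x = frechet_derivative f (at x) (axis j 1)"

definition dt :: "(real \<Rightarrow> 'a \<Rightarrow> 'b::real_normed_vector) \<Rightarrow> real \<Rightarrow> 'a \<Rightarrow> 'b" where
  "dt f t x = vector_derivative (\<lambda>s. f s x) (at t within {0..})"

definition laplacian :: "(real^'n::finite \<Rightarrow> 'b::real_normed_vector) \<Rightarrow> real^'n \<Rightarrow> 'b" where
  "laplacian f x = (\<Sum>j\<in>UNIV. dx j (dx j f) x)"

definition grad :: "(real^'n::finite \<Rightarrow> real) \<Rightarrow> real^'n \<Rightarrow> real^'n" where
  "grad f x = (\<chi> i. dx i f x)"

definition div_vec :: "(real^'n::finite \<Rightarrow> real^'n) \<Rightarrow> real^'n \<Rightarrow> real" where
  "div_vec u x = (\<Sum>i\<in>UNIV. dx i u x $ i)"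

definition div_mat :: "(real^'n::finite \<Rightarrow> real^'n^'n) \<Rightarrow> real^'n \<Rightarrow> real^'n" where
  "div_mat M x = (\<chi> i. \<Sum>j\<in>UNIV. dx j M x $ i $ j)"

definition material ::
  "(real \<Rightarrow> real^'n::finite \<Rightarrow> real^'n) \<Rightarrow> (real \<Rightarrow> real^'n \<Rightarrow> 'b::real_normed_vector)
    \<Rightarrow> real \<Rightarrow> real^'n \<Rightarrow> 'b" where
  "material v f t x = dt f t x + (\<Sum>j\<in>UNIV. (v t x $ j) *\<^sub>R dx j (f t) x)"

definition strain :: "(real^'n::finite \<Rightarrow> real^'n) \<Rightarrow> real^'n \<Rightarrow> real^'n^'n" where
  "strain u x = (\<chi> i j. (dx j u x $ i + dx i u x $ j) / 2)"

definition spin :: "(real^'n::finite \<Rightarrow> real^'n) \<Rightarrow> real^'n \<Rightarrow> real^'n^'n" where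
  "spin u x = (\<chi> i j. (dx j u x $ i - dx i u x $ j) / 2)"

definition comm :: "real^'n^'n \<Rightarrow> real^'n^'n \<Rightarrow> real^'n^'n::finite" where
  "comm M N = M ** N - N ** M"

definition grad_odot :: "(real^'n::finite \<Rightarrow> real^'n^'n) \<Rightarrow> real^'n \<Rightarrow> real^'n^'n" where
  "grad_odot q x = (\<chi> i j. \<Sum>k\<in>UNIV. \<Sum>l\<in>UNIV. (dx i q x $ k $ l) * (dx j q x $ k $ l))"

definition tensor_sq :: "real^'n^'n \<Rightarrow> real" where
  "tensor_sq M = trace (M ** M)"

definition grad_vec_sq :: "(real^'n::finite \<Rightarrow> real^'n) \<Rightarrow> real^'n \<Rightarrow> real" where
  "grad_vec_sq u x = (\<Sum>i\<in>UNIV. \<Sum>j\<in>UNIV. (dx j u x $ i)\<^sup>2)"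

definition grad_tensor_sq :: "(real^'n::finite \<Rightarrow> real^'n^'n) \<Rightarrow> real^'n \<Rightarrow> real" where
  "grad_tensor_sq q x = (\<Sum>i\<in>UNIV. \<Sum>j\<in>UNIV. \<Sum>k\<in>UNIV. (dx k q x $ i $ j)\<^sup>2)"

definition S0 :: "(real^'n^'n::finite) set" where
  "S0 = {q. (\<forall>i j. q $ i $ j = q $ j $ i) \<and> trace q = 0}"

definition psiB :: "real \<Rightarrow> real \<Rightarrow> real \<Rightarrow> real^'n^'n::finite \<Rightarrow> real" where
  "psiB a b c q =
     a / 2 * trace (q ** q) - b / 3 * trace (q ** q ** q) + c / 4 * (trace (q ** q))\<^sup>2"

text \<open>\<open>corot\<close> is \<open>\<dot>Q - [\<Omega>,Q]\<close>; the two stress tensors are the arguments of the two divergences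
  in the momentum equation.\<close>

definition corot ::
  "(real \<Rightarrow> real^'n::finite \<Rightarrow> real^'n) \<Rightarrow> (real \<Rightarrow> real^'n \<Rightarrow> real^'n^'n)
    \<Rightarrow> real \<Rightarrow> real^'n \<Rightarrow> real^'n^'n" where
  "corot v Q t x = material v Q t x - comm (spin (v t) x) (Q t x)"

definition stress1 ::
  "real \<Rightarrow> real \<Rightarrow> real \<Rightarrow> real \<Rightarrow> (real \<Rightarrow> real^'n::finite \<Rightarrow> real^'n)
    \<Rightarrow> (real \<Rightarrow> real^'n \<Rightarrow> real^'n^'n) \<Rightarrow> real \<Rightarrow> real^'n \<Rightarrow> real^'n^'n" where
  "stress1 L \<beta>1 \<beta>5 \<beta>6 v Q t x =
     (- L) *\<^sub>R grad_odot (Q t) x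
     + (\<beta>1 * trace (Q t x ** strain (v t) x)) *\<^sub>R Q t x
     + \<beta>5 *\<^sub>R (strain (v t) x ** Q t x) + \<beta>6 *\<^sub>R (Q t x ** strain (v t) x)"

definition stress2 ::
  "real \<Rightarrow> real \<Rightarrow> (real \<Rightarrow> real^'n::finite \<Rightarrow> real^'n)
    \<Rightarrow> (real \<Rightarrow> real^'n \<Rightarrow> real^'n^'n) \<Rightarrow> real \<Rightarrow> real^'n \<Rightarrow> real^'n^'n" where
  "stress2 \<mu>1 \<mu>2 v Q t x =
     (\<mu>2 / 2) *\<^sub>R corot v Q t x + \<mu>1 *\<^sub>R comm (Q t x) (corot v Q t x)"

definition C1_field :: "(real \<Rightarrow> real^'n::finite \<Rightarrow> 'b::real_normed_vector) \<Rightarrow> bool" where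
  "C1_field f \<longleftrightarrow>
     (\<lambda>(t, x). f t x) differentiable_on ({0..} \<times> UNIV)
     \<and> continuous_on ({0..} \<times> UNIV) (\<lambda>(t, x). dt f t x)
     \<and> (\<forall>j. continuous_on ({0..} \<times> UNIV) (\<lambda>(t, x). dx j (f t) x))"

text \<open>The regularity needed for every term of the system to be a continuous function: \<open>v\<close> once
  in time and twice in space, \<open>p\<close> once in space, \<open>Q\<close> twice in space-time.\<close>

definition classical_regularity ::
  "(real \<Rightarrow> real^'n::finite \<Rightarrow> real^'n) \<Rightarrow> (real \<Rightarrow> real^'n \<Rightarrow> real)
    \<Rightarrow> (real \<Rightarrow> real^'n \<Rightarrow> real^'n^'n) \<Rightarrow> bool" where
  "classical_regularity v p Q \<longleftrightarrow>
     C1_field v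
     \<and> (\<forall>j. \<forall>t\<ge>0. dx j (v t) differentiable_on UNIV)
     \<and> (\<forall>j k. continuous_on ({0..} \<times> UNIV) (\<lambda>(t, x). dx k (dx j (v t)) x))
     \<and> (\<forall>t\<ge>0. p t differentiable_on UNIV)
     \<and> (\<forall>j. continuous_on ({0..} \<times> UNIV) (\<lambda>(t, x). dx j (p t) x))
     \<and> C1_field Q \<and> C1_field (dt Q) \<and> (\<forall>j. C1_field (\<lambda>t. dx j (Q t)))"

definition qian_sheng_solution ::
  "real \<Rightarrow> real \<Rightarrow> real \<Rightarrow> real \<Rightarrow> real \<Rightarrow> real \<Rightarrow> real \<Rightarrow> real \<Rightarrow> real \<Rightarrow> real \<Rightarrow> real \<Rightarrow> real
    \<Rightarrow> (real \<Rightarrow> real^'n::finite \<Rightarrow> real^'n) \<Rightarrow> (real \<Rightarrow> real^'n \<Rightarrow> real)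
    \<Rightarrow> (real \<Rightarrow> real^'n \<Rightarrow> real^'n^'n) \<Rightarrow> bool" where
  "qian_sheng_solution J L a b c \<beta>1 \<beta>4 \<beta>5 \<beta>6 \<mu>1 \<mu>2 \<mu>2t v p Q \<longleftrightarrow>
     classical_regularity v p Q
     \<and> (\<forall>t\<ge>0. \<forall>x. Q t x \<in> S0)
     \<and> (\<forall>t\<ge>0. \<forall>x.
          material v v t x + grad (p t) x - (\<beta>4 / 2) *\<^sub>R laplacian (v t) x
          = div_mat (stress1 L \<beta>1 \<beta>5 \<beta>6 v Q t) x + div_mat (stress2 \<mu>1 \<mu>2 v Q t) x)
     \<and> (\<forall>t\<ge>0. \<forall>x. div_vec (v t) x = 0)
     \<and> (\<forall>t\<ge>0. \<forall>x.
          J *\<^sub>R material v (material v Q) t x + \<mu>1 *\<^sub>R material v Q t x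
          = L *\<^sub>R laplacian (Q t) x - a *\<^sub>R Q t x
            + b *\<^sub>R (Q t x ** Q t x - (tensor_sq (Q t x) / real CARD('n)) *\<^sub>R mat 1)
            - (c * tensor_sq (Q t x)) *\<^sub>R Q t x
            + (\<mu>2t / 2) *\<^sub>R strain (v t) x + \<mu>1 *\<^sub>R comm (spin (v t) x) (Q t x))"

definition int_by_parts :: "'n::finite \<Rightarrow> (real^'n \<Rightarrow> real) \<Rightarrow> (real^'n \<Rightarrow> real) \<Rightarrow> bool" where
  "int_by_parts j f g \<longleftrightarrow>
     integrable lborel (\<lambda>x. f x * dx j g x) \<and> integrable lborel (\<lambda>x. dx j f x * g x)
     \<and> (LINT x|lborel. f x * dx j g x) = - (LINT x|lborel. dx j f x * g x)"

text \<open>The density is integrable at each time, and locally uniformly in time its time derivative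
  has an integrable majorant, so that its integral may be differentiated in time.\<close>

definition good_density :: "(real \<Rightarrow> real^'n::finite \<Rightarrow> real) \<Rightarrow> bool" where
  "good_density e \<longleftrightarrow>
     (\<forall>t\<ge>0. integrable lborel (e t))
     \<and> (\<forall>T. \<exists>g. integrable lborel g \<and> (\<forall>t\<in>{0..T}. \<forall>x. \<bar>dt e t x\<bar> \<le> g x))"

text \<open>
  ``Decays fast enough at infinity'': the integrations by parts that arise from testing the
  momentum equation with \<open>v\<close> and the \<open>Q\<close>-equation with \<open>\<dot>Q\<close> and with \<open>Q\<close> produce no boundary
  terms, and the integrals whose time derivative appears in these tests can be differentiated.
  Here \<open>P = \<dot>Q\<close>.  In the momentum equation the integrations by parts concern, in turn, the
  convection, pressure, viscosity and stress terms.  In the \<open>Q\<close>-equation tested with \<open>P\<close> they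
  concern the inertial term, the elastic term \<open>L \<Delta>Q\<close> (twice: the second one removes the second
  derivatives from \<open>\<nabla>P : \<nabla>Q\<close>), and the transport of \<open>\<psi>_B(Q)\<close>.  In the one tested with \<open>Q\<close>
  they concern the inertial, damping and elastic terms.  Nothing here bounds the size of a
  solution by its initial data.
\<close>

definition decays_fast ::
  "real \<Rightarrow> real \<Rightarrow> real \<Rightarrow> real \<Rightarrow> real \<Rightarrow> real \<Rightarrow> real \<Rightarrow> real \<Rightarrow> real
    \<Rightarrow> (real \<Rightarrow> real^'n::finite \<Rightarrow> real^'n) \<Rightarrow> (real \<Rightarrow> real^'n \<Rightarrow> real)
    \<Rightarrow> (real \<Rightarrow> real^'n \<Rightarrow> real^'n^'n) \<Rightarrow> bool" where
  "decays_fast L a b c \<beta>1 \<beta>5 \<beta>6 \<mu>1 \<mu>2 v p Q \<longleftrightarrow> (let P = material v Q in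
     (\<forall>t\<ge>0. \<forall>i j.
        int_by_parts j (\<lambda>x. v t x $ j * v t x $ i) (\<lambda>x. v t x $ i)
        \<and> int_by_parts j (\<lambda>x. v t x $ j) (p t)
        \<and> int_by_parts j (\<lambda>x. v t x $ i) (\<lambda>x. dx j (v t) x $ i)
        \<and> int_by_parts j (\<lambda>x. v t x $ i) (\<lambda>x. stress1 L \<beta>1 \<beta>5 \<beta>6 v Q t x $ i $ j)
        \<and> int_by_parts j (\<lambda>x. v t x $ i) (\<lambda>x. stress2 \<mu>1 \<mu>2 v Q t x $ i $ j))
     \<and> (\<forall>t\<ge>0. \<forall>k l j.
        int_by_parts j (\<lambda>x. v t x $ j * P t x $ k $ l) (\<lambda>x. P t x $ k $ l)
        \<and> int_by_parts j (\<lambda>x. P t x $ k $ l) (\<lambda>x. dx j (Q t) x $ k $ l)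
        \<and> (\<forall>i. int_by_parts i (\<lambda>x. v t x $ i * dx j (Q t) x $ k $ l)
                              (\<lambda>x. dx j (Q t) x $ k $ l))
        \<and> int_by_parts j (\<lambda>x. v t x $ j) (\<lambda>x. psiB a b c (Q t x)))
     \<and> (\<forall>t\<ge>0. \<forall>k l j.
        int_by_parts j (\<lambda>x. v t x $ j * Q t x $ k $ l) (\<lambda>x. P t x $ k $ l)
        \<and> int_by_parts j (\<lambda>x. v t x $ j * Q t x $ k $ l) (\<lambda>x. Q t x $ k $ l)
        \<and> int_by_parts j (\<lambda>x. Q t x $ k $ l) (\<lambda>x. dx j (Q t) x $ k $ l))
     \<and> good_density (\<lambda>t x. (norm (v t x))\<^sup>2)
     \<and> good_density (\<lambda>t x. tensor_sq (P t x))
     \<and> good_density (\<lambda>t x. grad_tensor_sq (Q t) x)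
     \<and> good_density (\<lambda>t x. psiB a b c (Q t x))
     \<and> good_density (\<lambda>t x. trace (P t x ** Q t x))
     \<and> good_density (\<lambda>t x. tensor_sq (Q t x)))"

definition energy ::
  "real \<Rightarrow> real \<Rightarrow> real \<Rightarrow> real \<Rightarrow> real \<Rightarrow> (real \<Rightarrow> real^'n::finite \<Rightarrow> real^'n)
    \<Rightarrow> (real \<Rightarrow> real^'n \<Rightarrow> real^'n^'n) \<Rightarrow> real \<Rightarrow> real" where
  "energy J L a b c v Q t =
     (LINT x|lborel. 1 / 2 * ((norm (v t x))\<^sup>2 + J * tensor_sq (material v Q t x)
                              + L * grad_tensor_sq (Q t) x)
                     + psiB a b c (Q t x))"

definition coeff_assms ::
  "real \<Rightarrow> real \<Rightarrow> real \<Rightarrow> real \<Rightarrow> real \<Rightarrow> real \<Rightarrow> real \<Rightarrow> real \<Rightarrow> real \<Rightarrow> real \<Rightarrow> bool" where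
  "coeff_assms J L c \<beta>1 \<beta>4 \<beta>5 \<beta>6 \<mu>1 \<mu>2 \<mu>2t \<longleftrightarrow>
     \<beta>1 \<ge> 0 \<and> \<beta>4 \<ge> 0 \<and> \<mu>1 \<ge> 0 \<and> J > 0 \<and> L > 0
     \<and> \<beta>6 - \<beta>5 = \<mu>2 \<and> \<beta>5 + \<beta>6 = 0
     \<and> \<mu>2t \<in> {\<mu>2, - \<mu>2} \<and> (\<mu>2t = \<mu>2 \<longrightarrow> \<mu>2t = 0 \<and> \<mu>2 = 0)
     \<and> c > 0"

text \<open>
  The norms of \<open>v\<close> in \<open>L^\<infinity>(0,T;L^2)\<close> and \<open>L^2(0,T;H^1)\<close>, of \<open>Q\<close> in \<open>L^\<infinity>(0,T;H^1)\<close> and of \<open>\<dot>Q\<close>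
  in \<open>L^\<infinity>(0,T;L^2)\<close> (all squared) are at most \<open>K\<close>.  The integrals are nonnegative Lebesgue
  integrals, which are infinite rather than \<open>0\<close> for functions that are not integrable.
\<close>

definition star_bound ::
  "real \<Rightarrow> real \<Rightarrow> (real \<Rightarrow> real^'n::finite \<Rightarrow> real^'n)
    \<Rightarrow> (real \<Rightarrow> real^'n \<Rightarrow> real^'n^'n) \<Rightarrow> bool" where
  "star_bound T K v Q \<longleftrightarrow>
     (\<forall>t\<in>{0..T}.
        (\<integral>\<^sup>+x. ennreal ((norm (v t x))\<^sup>2) \<partial>lborel) \<le> ennreal K
        \<and> (\<integral>\<^sup>+x. ennreal (tensor_sq (Q t x) + grad_tensor_sq (Q t) x) \<partial>lborel) \<le> ennreal K
        \<and> (\<integral>\<^sup>+x. ennreal (tensor_sq (material v Q t x)) \<partial>lborel) \<le> ennreal K)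
     \<and> (\<integral>\<^sup>+t\<in>{0..T}. (\<integral>\<^sup>+x. ennreal ((norm (v t x))\<^sup>2 + grad_vec_sq (v t) x) \<partial>lborel) \<partial>lborel)
         \<le> ennreal K"

text \<open>
  ``A priori'': the bound \<open>K\<close> is uniform over all decaying classical solutions, for given
  coefficients, \<open>T\<close> and size \<open>M\<close> of the initial data.  The data are measured by the initial
  energy and the initial \<open>L^2\<close> norm of \<open>Q\<close>, both of which are controlled by the
  \<open>L^2 \<times> H^1 \<times> L^2\<close> norm of \<open>(v, Q, \<dot>Q)\<close> at time \<open>0\<close> because \<open>H^1 \<subseteq> L^4\<close> for \<open>d \<le> 3\<close>.  (For a
  single solution, finiteness of most of the norms would already be part of the decay assumption.)
\<close>

definition apriori_bounds ::
  "'n::finite itself \<Rightarrow> real \<Rightarrow> real \<Rightarrow> real \<Rightarrow> real \<Rightarrow> real \<Rightarrow> real \<Rightarrow> real \<Rightarrow> real \<Rightarrow> real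
    \<Rightarrow> real \<Rightarrow> real \<Rightarrow> real \<Rightarrow> bool" where
  "apriori_bounds (_ :: 'n itself) J L a b c \<beta>1 \<beta>4 \<beta>5 \<beta>6 \<mu>1 \<mu>2 \<mu>2t \<longleftrightarrow>
     (\<forall>T>0. \<forall>M. \<exists>K.
        \<forall>(v :: real \<Rightarrow> real^'n \<Rightarrow> real^'n) p (Q :: real \<Rightarrow> real^'n \<Rightarrow> real^'n^'n).
          qian_sheng_solution J L a b c \<beta>1 \<beta>4 \<beta>5 \<beta>6 \<mu>1 \<mu>2 \<mu>2t v p Q
          \<and> decays_fast L a b c \<beta>1 \<beta>5 \<beta>6 \<mu>1 \<mu>2 v p Q
          \<and> energy J L a b c v Q 0 \<le> M
          \<and> (LINT x|lborel. tensor_sq (Q 0 x)) \<le> M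
          \<longrightarrow> star_bound T K v Q)"

text \<open>
  Under \<open>coeff_assms\<close> the energy law reads, with \<open>N = \<dot>Q - [\<Omega>,Q]\<close>,
  \<open>dE/dt = - \<integral> (\<beta>4/2 |\<nabla>v|^2 + \<beta>1 tr(QA)^2 + \<mu>1 |N|^2 + \<mu>2 tr(AN)) dx\<close>.
  The mixed term can be absorbed only if \<open>\<beta>4 \<mu>1\<close> dominates \<open>\<mu>2^2\<close>, so a threshold for \<open>\<beta>4\<close> depends
  on \<open>\<mu>1\<close> as well.  If \<open>\<mu>1 = 0\<close> and \<open>\<mu>2 \<noteq> 0\<close> there is none: the right-hand side is positive at
  \<open>t = 0\<close> for data with \<open>Q = 0\<close> and \<open>N = - s A\<close>, \<open>s \<mu>2\<close> large.  That case is excluded by the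
  following condition.
\<close>

definition nondegenerate :: "real \<Rightarrow> real \<Rightarrow> bool" where
  "nondegenerate \<mu>1 \<mu>2 \<longleftrightarrow> \<mu>1 > 0 \<or> \<mu>2 = 0"

end

(*
Put V = grad v, A and Omega for its symmetric and skew parts, P for the material derivative of Q and
N = P - [Omega, Q].  Testing the momentum equation with v and the Q-equation with P, and using
beta6 = - beta5 = mu2 / 2 and mu2t = - mu2, shows that pointwise the time derivative of the energy
density is a sum of total derivatives minus
  beta4/2 |V|^2 + beta1 tr(QA)^2 + mu1 |N|^2 + mu2 A:N,
and this is at least eps |V|^2 with eps = beta4/2 - mu2^2/(4 mu1) > 0, because |A| <= |V|.

For the a priori bounds, add to the energy the multiple Lambda |Q|^2 with Lambda = |a|/2 + b^2/(9c) + 1/2.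
This absorbs the negative part of psi_B, and since d/dt int |Q|^2 = 2 int P:Q, the sum F satisfies
F' <= C F - eps int |V|^2: on a finite time interval Gronwall's inequality gives all the bounds.
*)
theory Submission
  imports Defs
begin

subsection \<open>Matrices and the bulk potential\<close>

text \<open>All pairings of matrices are Frobenius products. The cross terms cancel because, for
  symmetric Q and N, the commutator [Q,N] is skew and sees only the skew part of V: V:[Q,N] =
  -[Omega,Q]:N. So the stress yields exactly the terms in [Omega,Q] that the Q-equation yields with
  the opposite sign once P is split as N + [Omega,Q]. The elastic stress balances the commutator of
  the gradient with the transport v.grad, and the multiple of the identity drops out because P is
  trace-free, a linear constraint inherited from Q by differentiation.

  The analytic obstacle is that decay grants only the integrability that comes with each integration
  by parts and each density. Terms are therefore grouped so that each group integrates to zero as a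
  whole, and the dissipation is integrable as the remainder. Derivatives at the initial time are
  one-sided, which shapes the lemmas on mixed derivatives and on differentiation under the
  integral.\<close>

lemma inner_matrix: "(M :: real^'n^'n) \<bullet> N = (\<Sum>i\<in>UNIV. \<Sum>j\<in>UNIV. M $ i $ j * N $ i $ j)"
  by (simp add: inner_vec_def)

lemma inner_transpose: "transpose (M :: real^'n^'n) \<bullet> transpose N = M \<bullet> N"
  unfolding inner_matrix transpose_def by (simp, rule sum.swap)

lemma trace_matrix_mult: "trace ((M :: real^'n^'n) ** N) = transpose M \<bullet> N"
  unfolding inner_matrix transpose_def trace_def matrix_matrix_mult_def
  by (simp, rule sum.swap)

lemma transpose_diff: "transpose (M - N :: real^'n^'n) = transpose M - transpose N"
  by (simp add: transpose_def vec_eq_iff)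

text \<open>The adjoint of left multiplication for the Frobenius product; the next lemma is the
  adjoint of right multiplication. They move the factors of a commutator from one side of a pairing
  to the other.\<close>

lemma inner_matrix_mult_left:
  fixes X Y Z :: "real^'n^'n"
  shows "X \<bullet> (Y ** Z) = (transpose Y ** X) \<bullet> Z"
proof -
  have "X \<bullet> (Y ** Z) = trace (transpose X ** (Y ** Z))"
    by (simp add: trace_matrix_mult)
  also have "\<dots> = trace ((transpose X ** Y) ** Z)"
    by (simp add: matrix_mul_assoc)
  also have "\<dots> = (transpose Y ** X) \<bullet> Z"
    by (simp add: trace_matrix_mult matrix_transpose_mul)
  finally show ?thesis .
qed

lemma inner_matrix_mult_right:
  fixes X Y Z :: "real^'n^'n"
  shows "X \<bullet> (Y ** Z) = (X ** transpose Z) \<bullet> Y"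
proof -
  have "X \<bullet> (Y ** Z) = transpose X \<bullet> (transpose Z ** transpose Y)"
    by (metis inner_transpose matrix_transpose_mul)
  also have "\<dots> = (Z ** transpose X) \<bullet> transpose Y"
    by (simp add: inner_matrix_mult_left)
  also have "\<dots> = (X ** transpose Z) \<bullet> Y"
    by (metis inner_transpose matrix_transpose_mul transpose_transpose)
  finally show ?thesis .
qed

text \<open>This one fact supplies both the distributive laws collected below and the product rule
  for matrix fields.\<close>

lemma bounded_bilinear_matrix_mult:
  "bounded_bilinear ((**) :: real^'n^'n \<Rightarrow> real^'n^'n \<Rightarrow> real^'n^'n)"
  unfolding bilinear_conv_bounded_bilinear[symmetric] bilinear_def
  by (auto intro!: linearI simp: matrix_matrix_mult_def vec_eq_iff algebra_simps sum.distrib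
      sum_distrib_left)

lemmas matrix_mult_bilinear_simps =
  bounded_bilinear.minus_left[OF bounded_bilinear_matrix_mult]
  bounded_bilinear.minus_right[OF bounded_bilinear_matrix_mult]
  bounded_bilinear.add_left[OF bounded_bilinear_matrix_mult]
  bounded_bilinear.add_right[OF bounded_bilinear_matrix_mult]
  bounded_bilinear.diff_left[OF bounded_bilinear_matrix_mult]
  bounded_bilinear.diff_right[OF bounded_bilinear_matrix_mult]
  bounded_bilinear.scaleR_left[OF bounded_bilinear_matrix_mult]
  bounded_bilinear.scaleR_right[OF bounded_bilinear_matrix_mult]

text \<open>Cauchy-Schwarz for each entry, which is a row times a column. It controls the cubic term
  of the bulk potential by the cube of the norm.\<close>

lemma norm_matrix_mult_le:
  fixes M N :: "real^'n^'n"
  shows "norm (M ** N) \<le> norm M * norm N"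
proof (rule power2_le_imp_le)
  have entry: "(M ** N) $ i $ j = row i M \<bullet> column j N" for i j
    by (simp add: matrix_matrix_mult_def row_def column_def inner_vec_def)
  have "(norm (M ** N))\<^sup>2 = (\<Sum>i\<in>UNIV. \<Sum>j\<in>UNIV. (row i M \<bullet> column j N)\<^sup>2)"
    unfolding power2_norm_eq_inner inner_matrix entry by (simp add: power2_eq_square)
  also have "\<dots> \<le> (\<Sum>i\<in>UNIV. \<Sum>j\<in>UNIV. (row i M \<bullet> row i M) * (column j N \<bullet> column j N))"
    by (intro sum_mono Cauchy_Schwarz_ineq)
  also have "\<dots> = (\<Sum>i\<in>UNIV. row i M \<bullet> row i M) * (\<Sum>j\<in>UNIV. column j N \<bullet> column j N)"
    by (simp add: sum_product)
  also have "(\<Sum>i\<in>UNIV. row i M \<bullet> row i M) = M \<bullet> M"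
    by (simp add: inner_matrix row_def inner_vec_def)
  also have "(\<Sum>j\<in>UNIV. column j N \<bullet> column j N) = N \<bullet> N"
    unfolding inner_matrix column_def by (simp add: inner_vec_def, rule sum.swap)
  also have "(M \<bullet> M) * (N \<bullet> N) = (norm M * norm N)\<^sup>2"
    by (simp add: power_mult_distrib power2_norm_eq_inner)
  finally show "(norm (M ** N))\<^sup>2 \<le> (norm M * norm N)\<^sup>2" .
qed simp

lemma S0_iff: "q \<in> S0 \<longleftrightarrow> transpose q = q \<and> trace q = 0"
  by (auto simp: S0_def transpose_def vec_eq_iff)

lemma trace_eq_inner: "trace (M :: real^'n^'n) = M \<bullet> mat 1"
proof -
  have "M $ i $ j * (mat 1 :: real^'n^'n) $ i $ j = (if j = i then M $ i $ j else 0)" for i j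
    by (simp add: mat_def)
  then show ?thesis by (simp add: inner_matrix trace_def)
qed

lemma tensor_sq_symmetric: "transpose M = M \<Longrightarrow> tensor_sq M = M \<bullet> M"
  by (simp add: tensor_sq_def trace_matrix_mult)

lemma psiB_symmetric:
  assumes "transpose q = q"
  shows "psiB a b c q = a / 2 * (q \<bullet> q) - b / 3 * ((q ** q) \<bullet> q) + c / 4 * (q \<bullet> q)\<^sup>2"
  using assms by (simp add: psiB_def trace_matrix_mult matrix_transpose_mul)

section \<open>Symmetric and skew parts, and the work done by the stress\<close>

text \<open>Strain and spin as operations on a single matrix, so that the algebra of the stress can
  be settled without fields or derivatives.\<close>

definition sym_part :: "real^'n^'n \<Rightarrow> real^'n^'n" where
  "sym_part V = (1/2) *\<^sub>R (V + transpose V)"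

definition skew_part :: "real^'n^'n \<Rightarrow> real^'n^'n" where
  "skew_part V = (1/2) *\<^sub>R (V - transpose V)"

lemma transpose_sym_part: "transpose (sym_part V) = sym_part V"
  by (simp add: sym_part_def transpose_def vec_eq_iff add.commute)

lemma inner_sym_part: "transpose M = M \<Longrightarrow> sym_part V \<bullet> M = V \<bullet> M"
  using inner_transpose[of V M]
  by (simp add: sym_part_def inner_add_left)

lemma norm_sym_part_le: "norm (sym_part V) \<le> norm V"
proof -
  have "norm (transpose V) = norm V"
    by (simp add: norm_eq_sqrt_inner inner_transpose)
  then show ?thesis
    using norm_triangle_ineq[of V "transpose V"] by (simp add: sym_part_def)
qed

text \<open>Since \<open>comm Q N\<close> is skew for symmetric factors, the symmetric part of
  \<open>V\<close> does not contribute; moving \<open>Q\<close> across the product then turns the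
  rest into a commutator with the skew part.\<close>

lemma inner_comm_symmetric:
  assumes "transpose Q = Q" "transpose N = N"
  shows "V \<bullet> comm Q N = - (comm (skew_part V) Q \<bullet> N)"
proof -
  have 1: "V \<bullet> comm Q N = (Q ** V) \<bullet> N - (V ** Q) \<bullet> N"
    using assms by (simp add: comm_def inner_diff_right inner_matrix_mult_left[of V Q N]
        inner_matrix_mult_right[of V N Q])
  have 2: "(transpose V ** Q) \<bullet> N = (Q ** V) \<bullet> N" "(Q ** transpose V) \<bullet> N = (V ** Q) \<bullet> N"
    using assms inner_transpose[of "Q ** V" N] inner_transpose[of "V ** Q" N]
    by (simp_all add: matrix_transpose_mul)
  show ?thesis unfolding 1
    by (simp add: comm_def skew_part_def matrix_mult_bilinear_simps inner_diff_left inner_add_left 2)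
      (simp add: field_simps)
qed

text \<open>The two terms with coefficients -\<mu>2/2 and \<mu>2/2 form a multiple of [Q,A], so they
  and the \<mu>1-term both reduce to pairings with [W,Q]. Those pairings are what the Q-equation
  cancels later. The elastic stress is left out because it is balanced differently.\<close>

lemma inner_stress:
  fixes V Q N :: "real^'n^'n"
  assumes Q: "transpose Q = Q" and N: "transpose N = N"
  defines "A \<equiv> sym_part V" and "W \<equiv> skew_part V"
  shows "V \<bullet> ((\<beta>1 * trace (Q ** A)) *\<^sub>R Q + (- \<mu>2 / 2) *\<^sub>R (A ** Q) + (\<mu>2 / 2) *\<^sub>R (Q ** A)
              + ((\<mu>2 / 2) *\<^sub>R N + \<mu>1 *\<^sub>R comm Q N))
         = \<beta>1 * (Q \<bullet> A)\<^sup>2 - \<mu>2 / 2 * (comm W Q \<bullet> A) + \<mu>2 / 2 * (A \<bullet> N) - \<mu>1 * (comm W Q \<bullet> N)"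
proof -
  have A: "transpose A = A" by (simp add: A_def transpose_sym_part)
  have "V \<bullet> (Q ** A) - V \<bullet> (A ** Q) = - (comm W Q \<bullet> A)"
    using inner_comm_symmetric[OF Q A, of V] by (simp add: comm_def[of Q] W_def inner_diff_right)
  then have 1: "V \<bullet> (Q ** A) = V \<bullet> (A ** Q) - comm W Q \<bullet> A" by simp
  have 2: "V \<bullet> comm Q N = - (comm W Q \<bullet> N)"
    by (simp add: inner_comm_symmetric[OF Q N] W_def)
  have 3: "V \<bullet> Q = Q \<bullet> A" "V \<bullet> N = A \<bullet> N"
    using inner_sym_part[OF Q, of V] inner_sym_part[OF N, of V] by (simp_all add: A_def inner_commute)
  have 4: "trace (Q ** A) = Q \<bullet> A" using Q by (simp add: trace_matrix_mult)
  show ?thesis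
    unfolding inner_add_right inner_scaleR_right 1 2 3 4
    by (simp add: power2_eq_square algebra_simps)
qed

lemma transpose_comm_skew:
  assumes "transpose Q = Q"
  shows "transpose (comm (skew_part V) Q) = comm (skew_part V) Q"
proof -
  have "transpose (skew_part V) = - skew_part V"
    by (simp add: skew_part_def transpose_def vec_eq_iff field_simps)
  then show ?thesis
    using assms by (simp add: comm_def transpose_diff matrix_transpose_mul matrix_mult_bilinear_simps)
qed

section \<open>Pointwise bounds: dissipation and bulk potential\<close>

text \<open>If \<open>\<mu>1 = 0\<close>, then \<open>\<mu>2 = 0\<close> and the quotient by \<open>\<mu>1\<close> has the junk value \<open>0\<close>, which is the right one.\<close>

lemma dissipation_bound:
  fixes V N :: "real^'n^'n"
  assumes "0 \<le> \<mu>1" "\<mu>1 > 0 \<or> \<mu>2 = 0"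
  shows "(\<beta>4 / 2 - \<mu>2\<^sup>2 / (4 * \<mu>1)) * (V \<bullet> V)
          \<le> \<beta>4 / 2 * (V \<bullet> V) + \<mu>1 * (N \<bullet> N) + \<mu>2 * (sym_part V \<bullet> N)"
proof (cases "\<mu>1 = 0")
  case True
  then show ?thesis using assms by simp
next
  case False
  then have pos: "\<mu>1 > 0" using assms by simp
  have "\<bar>\<mu>2 * (sym_part V \<bullet> N)\<bar> \<le> \<bar>\<mu>2\<bar> * (norm V * norm N)"
    unfolding abs_mult
    by (intro mult_left_mono order_trans[OF Cauchy_Schwarz_ineq2] mult_right_mono norm_sym_part_le) auto
  moreover have "\<bar>\<mu>2\<bar> * (norm V * norm N) \<le> \<mu>1 * (norm N)\<^sup>2 + \<mu>2\<^sup>2 / (4 * \<mu>1) * (norm V)\<^sup>2"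
  proof -
    \<comment> \<open>Completing the square spends the whole damping \<mu>1 |N|^2 on the mixed term.
      What remains to be paid by viscosity is \<mu>2^2/(4 \<mu>1), the origin of the threshold for
      \<beta>4.\<close>
    have "0 \<le> (2 * \<mu>1 * norm N - \<bar>\<mu>2\<bar> * norm V)\<^sup>2 / (4 * \<mu>1)" using pos by simp
    also have "\<dots> = \<mu>1 * (norm N)\<^sup>2 + \<mu>2\<^sup>2 / (4 * \<mu>1) * (norm V)\<^sup>2 - \<bar>\<mu>2\<bar> * (norm V * norm N)"
      using pos by (simp add: field_simps power2_eq_square)
    finally show ?thesis by simp
  qed
  ultimately show ?thesis
    by (simp add: power2_norm_eq_inner left_diff_distrib)
qed

text \<open>The quartic term dominates the cubic one up to a multiple of |q|^2. The last 1/2 in the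
  constant is a reserve that leaves control of |q|^2 itself.\<close>

lemma psiB_lower_bound:
  assumes "transpose (q :: real^'n^'n) = q" "c > 0"
  shows "1/2 * (q \<bullet> q) \<le> psiB a b c q + (\<bar>a\<bar> / 2 + b\<^sup>2 / (9 * c) + 1/2) * (q \<bullet> q)"
proof -
  let ?r = "norm q"
  have "\<bar>(q ** q) \<bullet> q\<bar> \<le> ?r * ?r * ?r"
    by (rule order_trans[OF Cauchy_Schwarz_ineq2]) (intro mult_right_mono norm_matrix_mult_le, simp)
  then have "\<bar>b / 3 * ((q ** q) \<bullet> q)\<bar> \<le> \<bar>b\<bar> / 3 * (?r * ?r * ?r)"
    by (simp add: abs_mult mult_left_mono)
  moreover have "\<bar>b\<bar> / 3 * (?r * ?r * ?r) \<le> c / 4 * (?r\<^sup>2)\<^sup>2 + b\<^sup>2 / (9 * c) * ?r\<^sup>2"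
  proof -
    \<comment> \<open>The square in which the full quartic coefficient c/4 is used; its remaining
      term gives the constant b^2/(9c).\<close>
    have "0 \<le> ((3 * c * ?r\<^sup>2 - 2 * \<bar>b\<bar> * ?r)\<^sup>2) / (36 * c)" using assms by simp
    also have "\<dots> = c / 4 * (?r\<^sup>2)\<^sup>2 + b\<^sup>2 / (9 * c) * ?r\<^sup>2 - \<bar>b\<bar> / 3 * (?r * ?r * ?r)"
      using assms by (simp add: field_simps power2_eq_square)
    finally show ?thesis by simp
  qed
  moreover have "- (\<bar>a\<bar> / 2 * ?r\<^sup>2) \<le> a / 2 * ?r\<^sup>2"
    using mult_right_mono[of "- \<bar>a\<bar>" a "?r\<^sup>2 / 2"] by simp
  ultimately show ?thesis
    unfolding psiB_symmetric[OF assms(1)] power2_norm_eq_inner distrib_right by linarith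
qed

text \<open>By Cayley-Hamilton a trace-free symmetric 2 x 2 matrix squares to a multiple of the
  identity, so its cubic invariant vanishes and b has no influence. The proof checks this on
  entries.\<close>

lemma psiB_nonneg_dim2:
  assumes "CARD('n::finite) = 2" "a \<ge> 0" "c > 0" "q \<in> (S0 :: (real^'n^'n) set)"
  shows "psiB a b c q \<ge> 0"
proof -
  obtain i j :: 'n where ij: "UNIV = {i, j}" "i \<noteq> j" using assms(1) by (auto simp: card_2_iff)
  have t: "transpose q = q" and tr: "trace q = 0" using assms(4) by (auto simp: S0_iff)
  have q: "q $ j $ j = - q $ i $ i" "q $ j $ i = q $ i $ j"
    using tr t ij(2) unfolding trace_def ij(1) transpose_def by (auto simp: vec_eq_iff)
  have "(q ** q) \<bullet> q = 0"
    unfolding inner_matrix matrix_matrix_mult_def using ij(2) unfolding ij(1)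
    by (simp add: q algebra_simps)
  moreover have "a / 2 * (q \<bullet> q) \<ge> 0" "c / 4 * (q \<bullet> q)\<^sup>2 \<ge> 0" using assms by auto
  ultimately show ?thesis by (simp add: psiB_symmetric[OF t])
qed

lemma psiB_negative_dim2:
  assumes "CARD('n::finite) = 2" "a < 0" "c > 0"
  shows "\<exists>q \<in> (S0 :: (real^'n^'n) set). psiB a b c q < 0"
proof -
  obtain i j :: 'n where ij: "UNIV = {i, j}" "i \<noteq> j" using assms(1) by (auto simp: card_2_iff)
  \<comment> \<open>On diag(s, -s) the potential equals a s^2 + c s^4; this \<open>s\<close> is its
    minimiser, with value -a^2/(4c).\<close>
  define s where "s = sqrt (- a / (2 * c))"
  have s: "s * s = - a / (2 * c)" using assms by (simp add: s_def)
  define q :: "real^'n^'n" where "q = (\<chi> k l. if k = l then if k = i then s else - s else 0)"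
  have t: "transpose q = q" by (simp add: q_def transpose_def vec_eq_iff)
  have "trace q = 0" unfolding trace_def using ij(2) unfolding ij(1) by (simp add: q_def)
  moreover have "(q ** q) \<bullet> q = 0" "q \<bullet> q = 2 * (s * s)"
    unfolding inner_matrix matrix_matrix_mult_def using ij(2) unfolding ij(1) by (simp_all add: q_def)
  then have "psiB a b c q = - a\<^sup>2 / (4 * c)"
    using assms by (simp add: psiB_symmetric[OF t] s field_simps power2_eq_square)
  then have "psiB a b c q < 0" using assms by simp
  ultimately show ?thesis using t by (auto simp: S0_iff)
qed

lemma psiB_negative_dim3:
  assumes "CARD('n::finite) = 3" "c > 0"
  shows "\<exists>b. \<exists>q \<in> (S0 :: (real^'n^'n) set). psiB a b c q < 0"
proof -
  obtain i j k :: 'n where ijk: "UNIV = {i, j, k}" "i \<noteq> j" "j \<noteq> k" "i \<noteq> k"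
    using assms(1) by (auto simp: card_3_iff)
  \<comment> \<open>The uniaxial matrix diag(1, 1, -2) has nonzero cubic invariant, which is what
    distinguishes dimension three: the sign of b can be used.\<close>
  define q :: "real^'n^'n" where "q = (\<chi> m l. if m = l then if m = k then - 2 else 1 else 0)"
  have t: "transpose q = q" by (simp add: q_def transpose_def vec_eq_iff)
  have "trace q = 0" unfolding trace_def using ijk(2-4) unfolding ijk(1) by (simp add: q_def)
  moreover have "(q ** q) \<bullet> q = - 6" "q \<bullet> q = 6"
    unfolding inner_matrix matrix_matrix_mult_def using ijk(2-4) unfolding ijk(1) by (simp_all add: q_def)
  \<comment> \<open>At this matrix the potential is 3a + 2b + 9c, and b is chosen to make it
    -1.\<close>
  then have "psiB a (- (3 * a + 9 * c + 1) / 2) c q < 0"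
    by (simp add: psiB_symmetric[OF t] field_simps)
  ultimately show ?thesis using t by (intro exI bexI[of _ q]) (auto simp: S0_iff)
qed

subsection \<open>Calculus\<close>

lemmas has_frechet_derivative = frechet_derivative_works[THEN iffD1]

lemma dx_eq: "(f has_derivative F) (at x) \<Longrightarrow> dx j f x = F (axis j 1)"
  by (simp add: dx_def frechet_derivative_at[symmetric])

lemma dx_bounded_linear:
  assumes "bounded_linear h" "f differentiable (at x)"
  shows "dx j (\<lambda>x. h (f x)) x = h (dx j f x)"
  using dx_eq[OF bounded_linear.has_derivative[OF assms(1) has_frechet_derivative[OF assms(2)]]]
  by (simp add: dx_def)

lemma dx_add:
  assumes "f differentiable (at x)" "g differentiable (at x)"
  shows "dx j (\<lambda>x. f x + g x) x = dx j f x + dx j g x"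
  using dx_eq[OF has_derivative_add[OF has_frechet_derivative[OF assms(1)] has_frechet_derivative[OF assms(2)]]]
  by (simp add: dx_def)

lemma dx_bounded_bilinear:
  assumes "bounded_bilinear h" "f differentiable (at x)" "g differentiable (at x)"
  shows "dx j (\<lambda>x. h (f x) (g x)) x = h (f x) (dx j g x) + h (dx j f x) (g x)"
  using dx_eq[OF bounded_bilinear.FDERIV[OF assms(1) has_frechet_derivative[OF assms(2)]
      has_frechet_derivative[OF assms(3)]]]
  by (simp add: dx_def)

lemma dx_sum:
  assumes "\<And>i. i \<in> I \<Longrightarrow> f i differentiable (at x)"
  shows "dx j (\<lambda>x. \<Sum>i\<in>I. f i x) x = (\<Sum>i\<in>I. dx j (f i) x)"
proof -
  have "((\<lambda>x. \<Sum>i\<in>I. f i x) has_derivative (\<lambda>h. \<Sum>i\<in>I. frechet_derivative (f i) (at x) h)) (at x)"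
    using assms by (intro has_derivative_sum has_frechet_derivative)
  from dx_eq[OF this] show ?thesis by (simp add: dx_def)
qed

lemma dx_has_vector_derivative_line:
  assumes "f differentiable (at (x + r *\<^sub>R axis j 1))"
  shows "((\<lambda>r. f (x + r *\<^sub>R axis j 1)) has_vector_derivative dx j f (x + r *\<^sub>R axis j 1)) (at r within S)"
proof -
  let ?F = "frechet_derivative f (at (x + r *\<^sub>R axis j 1))"
  have "((\<lambda>r. x + r *\<^sub>R axis j 1) has_derivative (\<lambda>h. h *\<^sub>R axis j 1)) (at r within S)"
    by (auto intro!: derivative_eq_intros)
  from has_derivative_compose[OF this has_frechet_derivative[OF assms]]
  have "((\<lambda>r. f (x + r *\<^sub>R axis j 1)) has_derivative (\<lambda>h. ?F (h *\<^sub>R axis j 1))) (at r within S)" .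
  then show ?thesis
    using linear_scale[OF has_derivative_linear[OF has_frechet_derivative[OF assms]]]
    by (simp add: has_vector_derivative_def dx_def)
qed

text \<open>Gives uniqueness of derivatives within the half-line, including the one-sided derivative
  at time 0; without it \<open>dt\<close> would not be determined.\<close>

lemma at_within_atLeast_neq_bot: "0 \<le> (t::real) \<Longrightarrow> at t within {0..} \<noteq> bot"
  using trivial_limit_within[of t "{0..}"] islimpt_subset[of t "{t..t+1}" "{0..}"]
    islimpt_Icc[of t "t+1" t] by auto

lemma dt_eq:
  assumes "0 \<le> t" "((\<lambda>s. f s x) has_vector_derivative D) (at t within {0..})"
  shows "dt f t x = D"
  unfolding dt_def by (rule vector_derivative_within[OF at_within_atLeast_neq_bot assms(2)]) fact

lemma C1_field_differentiable:
  assumes "C1_field f" "0 \<le> t"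
  shows "f t differentiable (at x)"
proof -
  have "(\<lambda>(t, x). f t x) differentiable (at (t, x) within {0..} \<times> UNIV)"
    using assms by (auto simp: C1_field_def differentiable_on_def)
  then obtain F where F: "((\<lambda>(t, x). f t x) has_derivative F) (at (t, x) within {0..} \<times> UNIV)"
    by (auto simp: differentiable_def)
  have "((\<lambda>x. (t, x)) has_derivative (\<lambda>h. (0, h))) (at x)"
    by (auto intro!: derivative_eq_intros)
  moreover have "((\<lambda>(t, x). f t x) has_derivative F) (at (t, x) within range (\<lambda>x. (t, x)))"
    using assms(2) by (intro has_derivative_subset[OF F]) auto
  ultimately have "((\<lambda>x. case (t, x) of (t, x) \<Rightarrow> f t x) has_derivative (\<lambda>h. F (0, h))) (at x)"
    by (rule has_derivative_in_compose)
  then show ?thesis by (auto simp: differentiable_def)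
qed

lemma C1_field_has_dt:
  assumes "C1_field f" "0 \<le> t"
  shows "((\<lambda>s. f s x) has_vector_derivative dt f t x) (at t within {0..})"
proof -
  have "(\<lambda>(t, x). f t x) differentiable (at (t, x) within {0..} \<times> UNIV)"
    using assms by (auto simp: C1_field_def differentiable_on_def)
  then obtain F where F: "((\<lambda>(t, x). f t x) has_derivative F) (at (t, x) within {0..} \<times> UNIV)"
    by (auto simp: differentiable_def)
  have "((\<lambda>s. (s, x)) has_derivative (\<lambda>h. (h, 0))) (at t within {0..})"
    by (auto intro!: derivative_eq_intros)
  moreover have "((\<lambda>(t, x). f t x) has_derivative F) (at (t, x) within (\<lambda>s. (s, x)) ` {0..})"
    by (intro has_derivative_subset[OF F]) auto
  ultimately have "((\<lambda>s. case (s, x) of (t, x) \<Rightarrow> f t x) has_derivative (\<lambda>h. F (h, 0))) (at t within {0..})"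
    by (rule has_derivative_in_compose)
  then have "(\<lambda>s. f s x) differentiable (at t within {0..})" by (auto simp: differentiable_def)
  then show ?thesis unfolding dt_def by (simp add: vector_derivative_works[symmetric])
qed

section \<open>Symmetry of mixed derivatives\<close>

text \<open>Integrating \<open>fr\<close> in \<open>r\<close> and differentiating under the integral in \<open>s\<close> also works with one-sided
  derivatives, hence at the initial time.\<close>

lemma mixed_derivatives_eq:
  fixes f :: "real \<Rightarrow> real \<Rightarrow> 'b::banach"
  assumes fr: "\<And>s r. s \<in> U \<Longrightarrow> r \<in> {0..1} \<Longrightarrow> (f s has_vector_derivative fr s r) (at r within {0..1})"
    and fs: "\<And>r. r \<in> {0..1} \<Longrightarrow> ((\<lambda>s. f s r) has_vector_derivative fs r) (at t within U)"
    and frs: "\<And>s r. s \<in> U \<Longrightarrow> r \<in> {0..1} \<Longrightarrow> ((\<lambda>s. fr s r) has_vector_derivative frs s r) (at s within U)"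
    and fsr: "(fs has_vector_derivative D) (at 0 within {0..1})"
    and cont: "continuous_on (U \<times> {0..1}) (\<lambda>(s, r). frs s r)"
    and t0: "t \<in> U" "convex U" "at t within U \<noteq> bot"
  shows "D = frs t 0"
proof -
  have int: "((fr s) has_integral (f s r - f s 0)) {0..r}" if "s \<in> U" "r \<in> {0..1}" for s r
    using that by (intro fundamental_theorem_of_calculus)
      (auto intro: has_vector_derivative_within_subset[OF fr])
  \<comment> \<open>The increment of \<open>f s\<close> from 0 to \<open>r\<close> is differentiated
    at \<open>t\<close> in two ways: directly, and under the integral of \<open>fr s\<close>.
    Uniqueness of the derivative equates the results, and the identity is then differentiated in
    \<open>r\<close> at 0.\<close>
  have eq: "fs r - fs 0 = integral {0..r} (frs t)" if r: "r \<in> {0..1}" for r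
  proof (rule vector_derivative_unique_within[OF t0(3)])
    show "((\<lambda>s. f s r - f s 0) has_vector_derivative fs r - fs 0) (at t within U)"
      using fs[OF r] fs[of 0] by (auto intro: has_vector_derivative_diff)
    have "((\<lambda>s. integral (cbox 0 r) (fr s)) has_vector_derivative integral (cbox 0 r) (frs t)) (at t within U)"
    proof (rule leibniz_rule_vector_derivative[OF _ _ _ t0(1,2)])
      show "((\<lambda>x. fr x y) has_vector_derivative frs s y) (at s within U)" if "s \<in> U" "y \<in> cbox 0 r" for s y
        using that r by (intro frs) auto
      show "fr s integrable_on cbox 0 r" if "s \<in> U" for s
        using int[OF that r] by auto
      show "continuous_on (U \<times> cbox 0 r) (\<lambda>(x, y). frs x y)"
        using r by (intro continuous_on_subset[OF cont]) auto
    qed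
    then have "((\<lambda>s. integral {0..r} (fr s)) has_vector_derivative integral {0..r} (frs t)) (at t within U)"
      by simp
    then show "((\<lambda>s. f s r - f s 0) has_vector_derivative integral {0..r} (frs t)) (at t within U)"
      by (rule has_vector_derivative_transform[OF t0(1), rotated])
        (use int[OF _ r, THEN integral_unique] in simp)
  qed
  have "continuous_on {0..1} (\<lambda>r. case (t, r) of (s, r) \<Rightarrow> frs s r)"
    by (rule continuous_on_compose2[OF cont]) (use t0(1) in \<open>auto intro!: continuous_intros\<close>)
  then have "continuous_on {0..1} (frs t)"
    by simp
  then have "((\<lambda>r. integral {0..r} (frs t)) has_vector_derivative frs t 0) (at 0 within {0..1})"
    by (rule integral_has_vector_derivative) simp
  then have "((\<lambda>r. fs r - fs 0) has_vector_derivative frs t 0) (at 0 within {0..1})"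
    using eq by (auto intro: has_vector_derivative_transform)
  moreover have "((\<lambda>r. fs r - fs 0) has_vector_derivative D - 0) (at 0 within {0..1})"
    by (intro has_vector_derivative_diff fsr) (auto intro: derivative_eq_intros)
  moreover have "at 0 within {0..1::real} \<noteq> bot"
    using trivial_limit_within[of "0::real" "{0..1}"] islimpt_Icc[of 0 1 "0::real"] by auto
  ultimately show ?thesis
    using vector_derivative_unique_within by fastforce
qed

text \<open>Needed because the elastic energy is differentiated in time whereas the Q-equation is
  tested with P, whose gradient contains that of \<open>dt Q\<close>. Here \<open>s\<close> is time
  and \<open>r\<close> runs along a coordinate line through \<open>x\<close>.\<close>

lemma dt_dx_commute:
  fixes Q :: "real \<Rightarrow> real^'n \<Rightarrow> 'b::banach"
  assumes "C1_field Q" "C1_field (dt Q)" "C1_field (\<lambda>t. dx j (Q t))" "0 \<le> t"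
  shows "dt (\<lambda>t. dx j (Q t)) t x = dx j (dt Q t) x"
proof -
  let ?y = "\<lambda>r. x + r *\<^sub>R axis j 1"
  have "dx j (dt Q t) (?y 0) = dt (\<lambda>t. dx j (Q t)) t (?y 0)"
  proof (rule mixed_derivatives_eq[where f = "\<lambda>s r. Q s (?y r)" and U = "{0..}" and t = t and
        frs = "\<lambda>s r. dt (\<lambda>t. dx j (Q t)) s (?y r)"])
    show "((\<lambda>r. Q s (?y r)) has_vector_derivative dx j (Q s) (?y r)) (at r within {0..1})"
      if "s \<in> {0..}" for s r
      using that by (intro dx_has_vector_derivative_line C1_field_differentiable assms(1)) auto
    show "((\<lambda>s. Q s (?y r)) has_vector_derivative dt Q t (?y r)) (at t within {0..})" for r
      by (intro C1_field_has_dt assms)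
    show "((\<lambda>s. dx j (Q s) (?y r)) has_vector_derivative dt (\<lambda>t. dx j (Q t)) s (?y r)) (at s within {0..})"
      if "s \<in> {0..}" for s r
      using C1_field_has_dt[OF assms(3)] that by auto
    show "((\<lambda>r. dt Q t (?y r)) has_vector_derivative dx j (dt Q t) (?y 0)) (at 0 within {0..1})"
      by (intro dx_has_vector_derivative_line C1_field_differentiable assms)
    have "continuous_on ({0..} \<times> UNIV) (\<lambda>(t, x). dt (\<lambda>t. dx j (Q t)) t x)"
      using assms(3) by (simp add: C1_field_def)
    then have "continuous_on ({0..} \<times> {0..1})
        (\<lambda>p. case (fst p, ?y (snd p)) of (t, x) \<Rightarrow> dt (\<lambda>t. dx j (Q t)) t x)"
      by (rule continuous_on_compose2) (auto intro!: continuous_intros)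
    then show "continuous_on ({0..} \<times> {0..1}) (\<lambda>(s, r). dt (\<lambda>t. dx j (Q t)) s (?y r))"
      by (simp add: split_beta)
  qed (use assms at_within_atLeast_neq_bot in auto)
  then show ?thesis by simp
qed

text \<open>Differentiating the transport term of P gives v_i d_j d_i Q; exchanging the derivatives
  makes it transport of d_j Q, which integrates to zero against d_j Q.\<close>

lemma dx_dx_commute:
  fixes Q :: "real \<Rightarrow> real^'n \<Rightarrow> 'b::banach"
  assumes "C1_field Q" "\<And>j. C1_field (\<lambda>t. dx j (Q t))" "0 \<le> t"
  shows "dx i (dx j (Q t)) x = dx j (dx i (Q t)) x"
proof -
  have Q1: "dx j (Q t) differentiable (at y)" for j y
    using C1_field_differentiable[OF assms(2,3)] by simp
  let ?y = "\<lambda>s r. x + r *\<^sub>R axis j 1 + s *\<^sub>R axis i 1"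
  have y: "?y s r = x + s *\<^sub>R axis i 1 + r *\<^sub>R axis j 1" for s r
    by (simp add: algebra_simps)
  have "dx j (dx i (Q t)) (?y 0 0) = dx i (dx j (Q t)) (?y 0 0)"
  proof (rule mixed_derivatives_eq[where f = "\<lambda>s r. Q t (?y s r)" and U = "UNIV" and t = 0 and
        frs = "\<lambda>s r. dx i (dx j (Q t)) (?y s r)" and fr = "\<lambda>s r. dx j (Q t) (?y s r)" and
        fs = "\<lambda>r. dx i (Q t) (?y 0 r)"])
    show "((\<lambda>r. Q t (?y s r)) has_vector_derivative dx j (Q t) (?y s r)) (at r within {0..1})" for s r
      unfolding y by (intro dx_has_vector_derivative_line C1_field_differentiable assms)
    show "((\<lambda>s. Q t (?y s r)) has_vector_derivative dx i (Q t) (?y 0 r)) (at 0 within UNIV)" for r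
      by (intro dx_has_vector_derivative_line C1_field_differentiable assms)
    show "((\<lambda>s. dx j (Q t) (?y s r)) has_vector_derivative dx i (dx j (Q t)) (?y s r)) (at s within UNIV)"
      for s r
      by (intro dx_has_vector_derivative_line Q1)
    show "((\<lambda>r. dx i (Q t) (?y 0 r)) has_vector_derivative dx j (dx i (Q t)) (?y 0 0)) (at 0 within {0..1})"
      unfolding y by (intro dx_has_vector_derivative_line Q1)
    have "continuous_on ({0..} \<times> UNIV) (\<lambda>(t, x). dx i (dx j (Q t)) x)"
      using assms(2)[of j] by (simp add: C1_field_def)
    then have "continuous_on (UNIV \<times> {0..1})
        (\<lambda>p. case (t, ?y (fst p) (snd p)) of (t, x) \<Rightarrow> dx i (dx j (Q t)) x)"
      by (rule continuous_on_compose2) (use assms(3) in \<open>auto intro!: continuous_intros\<close>)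
    then show "continuous_on (UNIV \<times> {0..1}) (\<lambda>(s, r). dx i (dx j (Q t)) (?y s r))"
      by (simp add: split_beta)
  qed auto
  then show ?thesis by simp
qed

section \<open>Integrals depending on time\<close>

text \<open>Only the time derivative of \<open>e\<close> at each point is needed: its measurability in space is inherited
  from the difference quotients.\<close>

lemma good_density_has_derivative:
  fixes e :: "real \<Rightarrow> real^'n \<Rightarrow> real"
  assumes e: "good_density e"
    and de: "\<And>t x. 0 \<le> t \<Longrightarrow> ((\<lambda>s. e s x) has_real_derivative e' t x) (at t within {0..})"
    and t: "0 \<le> t"
  shows "integrable lborel (e' t)"
    and "((\<lambda>s. LINT x|lborel. e s x) has_real_derivative (LINT x|lborel. e' t x)) (at t within {0..})"
proof -
  have int: "integrable lborel (e s)" if "0 \<le> s" for s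
    using e that by (auto simp: good_density_def)
  have dt_e: "dt e s x = e' s x" if "0 \<le> s" for s x
    using de[OF that] by (intro dt_eq that) (auto simp: has_real_derivative_iff_has_vector_derivative)
  \<comment> \<open>Dominated convergence is a statement about sequences, so the limit is tested
    along an arbitrary sequence of times. Integrability of the limit comes out of the same
    argument.\<close>
  have main: "integrable lborel (e' t) \<and>
      (\<lambda>i. ((LINT x|lborel. e (X i) x) - (LINT x|lborel. e t x)) / (X i - t)) \<longlonglongrightarrow> (LINT x|lborel. e' t x)"
    if X: "\<And>i. X i \<in> {0..} - {t}" "X \<longlonglongrightarrow> t" for X
  proof -
    have "Bseq X" using X(2) convergentI convergent_imp_Bseq by blast
    then obtain K where K: "\<And>i. \<bar>X i\<bar> \<le> K" unfolding Bseq_def by auto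
    \<comment> \<open>A convergent sequence is bounded, so all times involved lie in one interval,
      for which \<open>good_density\<close> provides a single majorant.\<close>
    define T where "T = max K t"
    have T: "X i \<in> {0..T}" "t \<in> {0..T}" for i
      using K[of i] X(1)[of i] t by (auto simp: T_def)
    obtain g where g: "integrable lborel g" "\<And>s x. s \<in> {0..T} \<Longrightarrow> \<bar>e' s x\<bar> \<le> g x"
    proof -
      obtain g where "integrable lborel g" "\<forall>s\<in>{0..T}. \<forall>x. \<bar>dt e s x\<bar> \<le> g x"
        using e unfolding good_density_def by blast
      then show ?thesis using that dt_e by auto
    qed
    define q where "q i x = (e (X i) x - e t x) / (X i - t)" for i x
    have q_int: "integrable lborel (q i)" for i
      unfolding q_def using X(1)[of i] t by (intro integrable_divide Bochner_Integration.integrable_diff int) auto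
    have q_lim: "(\<lambda>i. q i x) \<longlonglongrightarrow> e' t x" for x
    proof -
      have "((\<lambda>s. (e s x - e t x) / (s - t)) \<longlongrightarrow> e' t x) (at t within {0..})"
        using de[OF t, of x] by (simp add: has_field_derivative_iff)
      then show ?thesis
        using X unfolding tendsto_at_iff_sequentially q_def by (auto simp: o_def)
    qed
    have q_bound: "norm (q i x) \<le> g x" for i x
    proof -
      \<comment> \<open>The mean value inequality transfers the majorant from the time derivative to
        the difference quotients.\<close>
      have "norm (e (X i) x - e t x) \<le> g x * norm (X i - t)"
      proof (rule field_differentiable_bound[where S = "{0..T}" and f' = "\<lambda>s. e' s x"])
        show "((\<lambda>s. e s x) has_real_derivative e' s x) (at s within {0..T})" if "s \<in> {0..T}" for s
          using that by (intro DERIV_subset[OF de]) auto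
      qed (use T g in auto)
      then show ?thesis
        using X(1)[of i] by (simp add: q_def field_simps)
    qed
    have meas: "e' t \<in> borel_measurable lborel"
      using q_lim borel_measurable_integrable[OF q_int] by (rule borel_measurable_LIMSEQ_real)
    have q_meas: "q i \<in> borel_measurable lborel" for i
      using borel_measurable_integrable[OF q_int] .
    have "(\<lambda>i. LINT x|lborel. q i x) \<longlonglongrightarrow> (LINT x|lborel. e' t x)"
      by (rule integral_dominated_convergence[OF meas q_meas g(1)]) (use q_lim q_bound in auto)
    moreover have "(LINT x|lborel. q i x)
        = ((LINT x|lborel. e (X i) x) - (LINT x|lborel. e t x)) / (X i - t)" for i
      unfolding q_def using X(1)[of i] t int by simp
    moreover have "integrable lborel (e' t)"
      by (rule Bochner_Integration.integrable_bound[OF g(1) meas]) (use order_trans[OF g(2)[OF T(2)] abs_ge_self] in simp)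
    ultimately show ?thesis by simp
  qed
  \<comment> \<open>One admissible sequence, approaching from the right so that it also exists at
    time 0.\<close>
  have "(\<lambda>i. t + 1 / real (Suc i)) \<longlonglongrightarrow> t + 0"
    by (intro tendsto_add tendsto_const LIMSEQ_Suc lim_1_over_n)
  then show "integrable lborel (e' t)"
    using main[of "\<lambda>i. t + 1 / real (Suc i)"] t by auto
  show "((\<lambda>s. LINT x|lborel. e s x) has_real_derivative (LINT x|lborel. e' t x)) (at t within {0..})"
    unfolding has_field_derivative_iff tendsto_at_iff_sequentially
    using main by (auto simp: o_def)
qed

lemma nonincreasing_if_derivative_nonpos:
  fixes f :: "real \<Rightarrow> real"
  assumes "\<And>t. 0 \<le> t \<Longrightarrow> (f has_real_derivative f' t) (at t within {0..})"
    and "\<And>t. 0 \<le> t \<Longrightarrow> f' t \<le> 0" and "0 \<le> t"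
  shows "f t \<le> f 0"
proof (cases "t = 0")
  case False
  then have "0 < t" using assms(3) by simp
  then have "\<exists>s\<in>{0<..<t}. f t - f 0 = f' s * (t - 0)"
    by (rule mvt_simple) (auto intro!: has_derivative_subset[OF assms(1)[unfolded has_field_derivative_def]])
  then obtain s where "0 < s" "f t - f 0 = f' s * t" by auto
  then show ?thesis
    using mult_nonpos_nonneg[OF assms(2)[of s] assms(3)] by simp
qed simp

lemma gronwall_exp:
  fixes F :: "real \<Rightarrow> real"
  assumes "\<And>t. 0 \<le> t \<Longrightarrow> (F has_real_derivative F' t) (at t within {0..})"
    and "\<And>t. 0 \<le> t \<Longrightarrow> F' t \<le> C * F t" and "0 \<le> t"
  shows "F t \<le> exp (C * t) * F 0"
proof -
  have "exp (- (C * t)) * F t \<le> exp (- (C * 0)) * F 0"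
  proof (rule nonincreasing_if_derivative_nonpos[OF _ _ assms(3)])
    show "((\<lambda>t. exp (- (C * t)) * F t) has_real_derivative exp (- (C * t)) * (F' t - C * F t))
            (at t within {0..})" if "0 \<le> t" for t
      by (auto intro!: derivative_eq_intros assms(1) that simp: algebra_simps)
    show "exp (- (C * t)) * (F' t - C * F t) \<le> 0" if "0 \<le> t" for t
      using assms(2)[OF that] by (auto intro!: mult_nonneg_nonpos)
  qed
  then show ?thesis by (simp add: exp_minus field_simps)
qed

text \<open>Nothing is known about measurability of \<open>g\<close>. The nonnegative integral is
  monotone for arbitrary functions, so \<open>g\<close> is compared with the derivative
  \<open>- H'\<close>, whose integral follows from the fundamental theorem even without
  continuity.\<close>

lemma nn_integral_dissipation_le:
  fixes H :: "real \<Rightarrow> real"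
  assumes H: "\<And>t. 0 \<le> t \<Longrightarrow> t \<le> T \<Longrightarrow> (H has_real_derivative H' t) (at t within {0..})"
    and g: "\<And>t. 0 \<le> t \<Longrightarrow> t \<le> T \<Longrightarrow> 0 \<le> g t \<and> g t \<le> - H' t" and T: "0 \<le> T"
  shows "(\<integral>\<^sup>+t\<in>{0..T}. ennreal (g t) \<partial>lborel) \<le> ennreal (H 0 - H T)"
proof -
  have "((\<lambda>t. - H' t) has_integral (- H T - (- H 0))) {0..T}"
  proof (rule fundamental_theorem_of_calculus[OF T])
    show "((\<lambda>t. - H t) has_vector_derivative - H' t) (at t within {0..T})" if "t \<in> {0..T}" for t
      using that unfolding has_real_derivative_iff_has_vector_derivative[symmetric]
      by (intro DERIV_minus DERIV_subset[OF H]) auto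
  qed
  then have "(\<integral>\<^sup>+t\<in>{0..T}. ennreal (- H' t) \<partial>lborel) = ennreal (- H T - (- H 0))"
    using order_trans[OF conjunct1[OF g] conjunct2[OF g]]
    by (intro nn_integral_has_integral_lebesgue') auto
  moreover have "(\<integral>\<^sup>+t\<in>{0..T}. ennreal (g t) \<partial>lborel) \<le> (\<integral>\<^sup>+t\<in>{0..T}. ennreal (- H' t) \<partial>lborel)"
    using g by (intro nn_integral_mono) (auto simp: indicator_def intro!: ennreal_leI)
  ultimately show ?thesis by simp
qed

section \<open>Null integrals, entries of fields and the gradient of the bulk potential\<close>

text \<open>In this form, value and integrability travel together, and null terms can be added with
  the linearity rules of \<open>has_bochner_integral\<close>.\<close>

lemma int_by_parts_has_integral:
  assumes "int_by_parts j f g"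
  shows "has_bochner_integral lborel (\<lambda>x. f x * dx j g x + dx j f x * g x) 0"
  using assms has_bochner_integral_add[of lborel "\<lambda>x. f x * dx j g x" _ "\<lambda>x. dx j f x * g x"]
  by (auto simp: int_by_parts_def has_bochner_integral_iff)

lemma differentiable_bounded_linear:
  "bounded_linear h \<Longrightarrow> f differentiable F \<Longrightarrow> (\<lambda>x. h (f x)) differentiable F"
  by (auto simp: differentiable_def intro: bounded_linear.has_derivative)

lemma differentiable_bounded_bilinear:
  "bounded_bilinear h \<Longrightarrow> f differentiable (at x within S) \<Longrightarrow> g differentiable (at x within S)
    \<Longrightarrow> (\<lambda>x. h (f x) (g x)) differentiable (at x within S)"
  unfolding differentiable_def using bounded_bilinear.FDERIV by blast

lemma bounded_linear_nth_nth: "bounded_linear (\<lambda>M :: real^'n^'m. M $ i $ j)"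
  by (rule bounded_linear_compose[OF bounded_linear_vec_nth bounded_linear_vec_nth])

lemma differentiable_nth: "f differentiable F \<Longrightarrow> (\<lambda>x. (f x :: real^'n) $ i) differentiable F"
  by (rule differentiable_bounded_linear[OF bounded_linear_vec_nth])

lemma differentiable_nth_nth:
  "f differentiable F \<Longrightarrow> (\<lambda>x. (f x :: real^'n^'m) $ i $ j) differentiable F"
  by (rule differentiable_bounded_linear[OF bounded_linear_nth_nth])

lemma dx_nth: "f differentiable (at x) \<Longrightarrow> dx j (\<lambda>x. (f x :: real^'m) $ i) x = dx j f x $ i"
  by (rule dx_bounded_linear[OF bounded_linear_vec_nth])

lemma dx_nth_nth:
  "f differentiable (at x) \<Longrightarrow> dx j (\<lambda>x. (f x :: real^'m^'l) $ i $ k) x = dx j f x $ i $ k"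
  by (rule dx_bounded_linear[OF bounded_linear_nth_nth])

lemma differentiable_matrixI:
  fixes M :: "'a::real_normed_vector \<Rightarrow> real^'n^'n"
  assumes "\<And>i j. (\<lambda>x. M x $ i $ j) differentiable (at x within S)"
  shows "M differentiable (at x within S)"
proof -
  have "M = (\<lambda>x. \<Sum>i\<in>UNIV. \<Sum>j\<in>UNIV. M x $ i $ j *\<^sub>R axis i (axis j 1))"
  proof -
    have "M x $ i $ j * (axis i (axis j 1) $ k $ l) = (if i = k then if j = l then M x $ i $ j else 0 else 0)"
      for x i j k l by (simp add: axis_def)
    moreover have "(\<Sum>i\<in>UNIV. \<Sum>j\<in>UNIV. if i = k then if j = l then M x $ i $ j else 0 else 0) = M x $ k $ l"
      for x k l by (subst sum.swap) simp
    ultimately show ?thesis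
      by (simp add: fun_eq_iff vec_eq_iff)
  qed
  moreover have "(\<lambda>x. \<Sum>i\<in>UNIV. \<Sum>j\<in>UNIV. M x $ i $ j *\<^sub>R axis i (axis j (1::real)))
      differentiable (at x within S)"
    by (intro differentiable_sum finite differentiable_scaleR differentiable_const assms ballI)
  ultimately show ?thesis by simp
qed

lemma bounded_linear_trace: "bounded_linear (trace :: real^'n^'n \<Rightarrow> real)"
  unfolding trace_eq_inner by (rule bounded_linear_inner_left)

text \<open>The Frobenius gradient of the bulk potential at symmetric matrices. It is not projected
  to trace-free matrices: the missing multiple of the identity is orthogonal to P.\<close>

definition bulk_force :: "real \<Rightarrow> real \<Rightarrow> real \<Rightarrow> real^'n^'n \<Rightarrow> real^'n^'n" where
  "bulk_force a b c q = a *\<^sub>R q - b *\<^sub>R (q ** q) + (c * (q \<bullet> q)) *\<^sub>R q"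

text \<open>Cyclicity of the trace collects the two or three terms of the product rule into one.
  Symmetry enters only at the base point, to turn traces into inner products.\<close>

lemma psiB_has_derivative:
  assumes q: "(q has_derivative q') (at x within S)" and sym: "transpose (q x) = q x"
  shows "((\<lambda>y. psiB a b c (q y)) has_derivative (\<lambda>h. bulk_force a b c (q x) \<bullet> q' h)) (at x within S)"
proof -
  note mult = bounded_bilinear.FDERIV[OF bounded_bilinear_matrix_mult]
  note tr = bounded_linear.has_derivative[OF bounded_linear_trace]
  have q2: "((\<lambda>y. trace (q y ** q y)) has_derivative (\<lambda>h. 2 * (q x \<bullet> q' h))) (at x within S)"
  proof (rule has_derivative_eq_rhs[OF tr[OF mult[OF q q]]], rule ext)
    fix h
    have "trace (q' h ** q x) = trace (q x ** q' h)"
      by (rule trace_mul_sym)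
    then show "trace (q x ** q' h + q' h ** q x) = 2 * (q x \<bullet> q' h)"
      by (simp add: trace_add trace_matrix_mult sym)
  qed
  have q3: "((\<lambda>y. trace (q y ** q y ** q y)) has_derivative (\<lambda>h. 3 * ((q x ** q x) \<bullet> q' h))) (at x within S)"
  proof (rule has_derivative_eq_rhs[OF tr[OF mult[OF mult[OF q q] q]]], rule ext)
    fix h
    have "trace (q x ** q' h ** q x) = trace (q x ** q x ** q' h)"
      by (metis matrix_mul_assoc trace_mul_sym)
    moreover have "trace (q' h ** q x ** q x) = trace (q x ** q x ** q' h)"
      by (metis matrix_mul_assoc trace_mul_sym)
    moreover have "trace (q x ** q x ** q' h) = (q x ** q x) \<bullet> q' h"
      by (simp add: trace_matrix_mult matrix_transpose_mul sym)
    ultimately show "trace (q x ** q x ** q' h + (q x ** q' h + q' h ** q x) ** q x) = 3 * ((q x ** q x) \<bullet> q' h)"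
      by (simp add: trace_add matrix_mult_bilinear_simps)
  qed
  show ?thesis
    unfolding psiB_def power2_eq_square
  proof (rule has_derivative_eq_rhs)
    show "((\<lambda>y. a / 2 * trace (q y ** q y) - b / 3 * trace (q y ** q y ** q y)
           + c / 4 * (trace (q y ** q y) * trace (q y ** q y))) has_derivative
        (\<lambda>h. a / 2 * (2 * (q x \<bullet> q' h)) - b / 3 * (3 * ((q x ** q x) \<bullet> q' h))
           + c / 4 * (trace (q x ** q x) * (2 * (q x \<bullet> q' h)) + 2 * (q x \<bullet> q' h) * trace (q x ** q x))))
        (at x within S)"
      by (intro has_derivative_add has_derivative_diff has_derivative_mult has_derivative_mult_right q2 q3)
  qed (simp add: fun_eq_iff bulk_force_def inner_add_left inner_diff_left trace_matrix_mult sym algebra_simps)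
qed

lemma has_real_derivative_inner:
  fixes f g :: "real \<Rightarrow> 'a::real_inner"
  assumes "(f has_vector_derivative f') (at t within S)" "(g has_vector_derivative g') (at t within S)"
  shows "((\<lambda>s. f s \<bullet> g s) has_real_derivative (f t \<bullet> g' + f' \<bullet> g t)) (at t within S)"
  using bounded_bilinear.has_vector_derivative[OF bounded_bilinear_inner assms]
  by (simp add: has_real_derivative_iff_has_vector_derivative)

lemma set_nn_integral_mono:
  "(\<And>x. x \<in> S \<Longrightarrow> f x \<le> g x) \<Longrightarrow> (\<integral>\<^sup>+x\<in>S. f x \<partial>M) \<le> (\<integral>\<^sup>+x\<in>S. g x \<partial>M)"
  by (rule nn_integral_mono) (simp add: indicator_def)

text \<open>Defined in terms of the coefficients alone, since it enters an a priori bound that must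
  be the same for all solutions.\<close>

definition coercivity_shift :: "real \<Rightarrow> real \<Rightarrow> real \<Rightarrow> real" where
  "coercivity_shift a b c = \<bar>a\<bar> / 2 + b\<^sup>2 / (9 * c) + 1/2"

subsection \<open>The energy law\<close>

locale qs_solution =
  fixes J L a b c \<beta>1 \<beta>4 \<beta>5 \<beta>6 \<mu>1 \<mu>2 \<mu>2t :: real
    and v :: "real \<Rightarrow> real^'n::finite \<Rightarrow> real^'n"
    and p :: "real \<Rightarrow> real^'n \<Rightarrow> real"
    and Q :: "real \<Rightarrow> real^'n \<Rightarrow> real^'n^'n"
  assumes solution: "qian_sheng_solution J L a b c \<beta>1 \<beta>4 \<beta>5 \<beta>6 \<mu>1 \<mu>2 \<mu>2t v p Q"
    and decay: "decays_fast L a b c \<beta>1 \<beta>5 \<beta>6 \<mu>1 \<mu>2 v p Q"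
    and coeff: "coeff_assms J L c \<beta>1 \<beta>4 \<beta>5 \<beta>6 \<mu>1 \<mu>2 \<mu>2t"
begin

abbreviation "P \<equiv> material v Q"

abbreviation "A t x \<equiv> strain (v t) x"

abbreviation "N \<equiv> corot v Q"

definition V where "V t x = (\<chi> i j. dx j (v t) x $ i)"

lemma strain_eq: "strain (v t) x = sym_part (V t x)"
  by (simp add: strain_def sym_part_def V_def transpose_def vec_eq_iff)

lemma spin_eq: "spin (v t) x = skew_part (V t x)"
  by (simp add: spin_def skew_part_def V_def transpose_def vec_eq_iff)

lemma C1: "C1_field v" "C1_field Q" "C1_field (dt Q)" "C1_field (\<lambda>t. dx j (Q t))"
  using solution unfolding qian_sheng_solution_def classical_regularity_def by blast+

lemma differentiable_fields [simp, intro]: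
  assumes "0 \<le> t"
  shows "v t differentiable (at x)" "dx j (v t) differentiable (at x)"
    "Q t differentiable (at x)" "dt Q t differentiable (at x)" "dx j (Q t) differentiable (at x)"
proof -
  have "dx j (v t) differentiable_on UNIV"
    using solution assms unfolding qian_sheng_solution_def classical_regularity_def by blast
  then show "dx j (v t) differentiable (at x)"
    by (simp add: differentiable_on_def)
qed (use C1[THEN C1_field_differentiable, OF assms] in auto)

lemma P_eq: "P t = (\<lambda>x. dt Q t x + (\<Sum>j\<in>UNIV. (v t x $ j) *\<^sub>R dx j (Q t) x))"
  by (simp add: fun_eq_iff material_def)

lemma diff_P [simp, intro]: "0 \<le> t \<Longrightarrow> P t differentiable (at x)"
  unfolding P_eq
  by (intro differentiable_add differentiable_sum differentiable_scaleR differentiable_nth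
      differentiable_fields finite ballI)

lemma dx_P:
  assumes "0 \<le> t"
  shows "dx k (P t) x = dx k (dt Q t) x
    + (\<Sum>j\<in>UNIV. (v t x $ j) *\<^sub>R dx k (dx j (Q t)) x + (dx k (v t) x $ j) *\<^sub>R dx j (Q t) x)"
proof -
  have d: "(\<lambda>x. (v t x $ j) *\<^sub>R dx j (Q t) x) differentiable (at x)" for j
    using assms by (intro differentiable_scaleR differentiable_nth) auto
  have "dx k (\<lambda>x. (v t x $ j) *\<^sub>R dx j (Q t) x) x
      = (v t x $ j) *\<^sub>R dx k (dx j (Q t)) x + (dx k (v t) x $ j) *\<^sub>R dx j (Q t) x" for j
    using assms by (subst dx_bounded_bilinear[OF bounded_bilinear_scaleR]) (auto simp: dx_nth intro: differentiable_nth)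
  then show ?thesis
    unfolding P_eq using assms
    by (subst dx_add) (auto simp: dx_sum d intro!: differentiable_sum)
qed

lemma has_dt_v: "0 \<le> t \<Longrightarrow> ((\<lambda>s. v s x) has_vector_derivative dt v t x) (at t within {0..})"
  by (rule C1_field_has_dt[OF C1(1)])

lemma has_dt_Q: "0 \<le> t \<Longrightarrow> ((\<lambda>s. Q s x) has_vector_derivative dt Q t x) (at t within {0..})"
  by (rule C1_field_has_dt[OF C1(2)])

lemma has_dt_dx_Q: "0 \<le> t \<Longrightarrow>
    ((\<lambda>s. dx j (Q s) x) has_vector_derivative dx j (dt Q t) x) (at t within {0..})"
  using C1_field_has_dt[OF C1(4)] dt_dx_commute[OF C1(2-4)] by simp

text \<open>The explicit derivative in the proof serves only as a witness of differentiability;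
  afterwards \<open>dt P\<close> is taken from the Q-equation.\<close>

lemma has_dt_P:
  assumes "0 \<le> t"
  shows "((\<lambda>s. P s x) has_vector_derivative dt P t x) (at t within {0..})"
proof -
  have "((\<lambda>s. v s x $ j) has_real_derivative dt v t x $ j) (at t within {0..})" for j
    using bounded_linear.has_vector_derivative[OF bounded_linear_vec_nth has_dt_v[OF assms]]
    by (simp add: has_real_derivative_iff_has_vector_derivative)
  then have "((\<lambda>s. P s x) has_vector_derivative dt (dt Q) t x + (\<Sum>j\<in>UNIV.
      (v t x $ j) *\<^sub>R dx j (dt Q t) x + (dt v t x $ j) *\<^sub>R dx j (Q t) x)) (at t within {0..})"
    unfolding P_eq
    by (intro has_vector_derivative_add has_vector_derivative_sum has_vector_derivative_scaleR
        C1_field_has_dt[OF C1(3) assms] has_dt_dx_Q[OF assms])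
  then show ?thesis
    unfolding dt_def by (rule vector_derivative_works[THEN iffD1, OF differentiableI_vector])
qed

lemma Q_S0: "0 \<le> t \<Longrightarrow> Q t x \<in> S0"
  using solution unfolding qian_sheng_solution_def by blast

text \<open>A linear constraint on Q holds at all points and times, so it passes to the derivatives
  of Q, one-sided at time 0, and to their linear combination P. It is applied to symmetry and to the
  trace.\<close>

lemma linear_vanishing_P:
  assumes h: "bounded_linear h" "\<And>q. q \<in> S0 \<Longrightarrow> h q = 0" and t: "0 \<le> t"
  shows "h (P t x) = 0"
proof -
  have "((\<lambda>s. 0) has_vector_derivative h (dt Q t x)) (at t within {0..})"
    by (rule has_vector_derivative_transform[OF _ _ bounded_linear.has_vector_derivative[OF h(1) has_dt_Q[OF t, of x]]])
      (use t h(2) Q_S0 in auto)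
  then have "h (dt Q t x) = 0"
    using vector_derivative_unique_within[OF at_within_atLeast_neq_bot[OF t] has_vector_derivative_const]
    by metis
  moreover have "h (dx j (Q t) x) = 0" for j
  proof -
    have "h (dx j (Q t) x) = dx j (\<lambda>x. h (Q t x)) x"
      using t by (simp add: dx_bounded_linear[OF h(1)])
    also have "(\<lambda>x. h (Q t x)) = (\<lambda>x. 0)"
      using h(2) Q_S0[OF t] by auto
    finally show ?thesis
      using dx_eq[OF has_derivative_const] by metis
  qed
  ultimately show ?thesis
    using bounded_linear.linear[OF h(1)] by (simp add: P_eq linear_add linear_sum linear_scale)
qed

lemma symmetric_fields [simp]:
  assumes "0 \<le> t"
  shows "transpose (Q t x) = Q t x" "transpose (P t x) = P t x" "trace (P t x) = 0"
    "transpose (N t x) = N t x"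
proof -
  show Q: "transpose (Q t x) = Q t x" using Q_S0[OF assms, of x] by (simp add: S0_iff)
  have "bounded_linear (\<lambda>M :: real^'n^'n. transpose M - M)"
    unfolding linear_conv_bounded_linear[symmetric]
    by (rule linearI) (simp_all add: transpose_def vec_eq_iff algebra_simps)
  from linear_vanishing_P[OF this _ assms, of x]
  show P: "transpose (P t x) = P t x" by (simp add: S0_iff)
  show "trace (P t x) = 0"
    using linear_vanishing_P[OF bounded_linear_trace _ assms, of x] by (simp add: S0_iff)
  show "transpose (N t x) = N t x"
    by (simp add: corot_def spin_eq transpose_diff P transpose_comm_skew[OF Q])
qed

section \<open>Transport by a divergence-free velocity\<close>

lemma divergence_free: "0 \<le> t \<Longrightarrow> (\<Sum>j\<in>UNIV. dx j (v t) x $ j) = 0"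
  using solution unfolding qian_sheng_solution_def div_vec_def by blast

text \<open>Incompressibility makes v.grad g the divergence of v g.\<close>

lemma transport_null:
  assumes "0 \<le> t" "\<And>j. int_by_parts j (\<lambda>x. v t x $ j) g"
  shows "has_bochner_integral lborel (\<lambda>x. \<Sum>j\<in>UNIV. v t x $ j * dx j g x) 0"
proof -
  have "has_bochner_integral lborel (\<lambda>x. \<Sum>j\<in>UNIV.
      v t x $ j * dx j g x + dx j (\<lambda>x. v t x $ j) x * g x) (\<Sum>j\<in>(UNIV :: 'n set). 0)"
    by (intro has_bochner_integral_sum int_by_parts_has_integral assms)
  then show ?thesis
    using assms(1) divergence_free[OF assms(1)]
    by (simp add: dx_nth sum.distrib sum_distrib_right[symmetric])
qed

text \<open>Integrating v_j h against d_j h produces the same term twice plus (d_j v_j) h^2. Only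
  after summation over j does the last term vanish, so the sum is taken before the factor 2 is
  removed.\<close>

lemma transport_null_sq:
  assumes "0 \<le> t" "\<And>j. int_by_parts j (\<lambda>x. v t x $ j * h x) h" "\<And>x. h differentiable (at x)"
  shows "has_bochner_integral lborel (\<lambda>x. \<Sum>j\<in>UNIV. v t x $ j * (h x * dx j h x)) 0"
proof -
  have "dx j (\<lambda>x. v t x $ j * h x) x = v t x $ j * dx j h x + dx j (v t) x $ j * h x" for j x
    using assms by (subst dx_bounded_bilinear[OF bounded_bilinear_mult]) (auto simp: dx_nth intro: differentiable_nth)
  then have eq: "v t x $ j * h x * dx j h x + dx j (\<lambda>x. v t x $ j * h x) x * h x
      = 2 * (v t x $ j * (h x * dx j h x)) + dx j (v t) x $ j * (h x * h x)" for j x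
    by (simp add: algebra_simps)
  have "(\<Sum>j\<in>UNIV. v t x $ j * h x * dx j h x + dx j (\<lambda>x. v t x $ j * h x) x * h x)
      = 2 * (\<Sum>j\<in>UNIV. v t x $ j * (h x * dx j h x))" for x
    unfolding eq sum.distrib sum_distrib_left[symmetric] sum_distrib_right[symmetric]
      divergence_free[OF assms(1)] by simp
  moreover have "has_bochner_integral lborel (\<lambda>x. \<Sum>j\<in>UNIV.
      v t x $ j * h x * dx j h x + dx j (\<lambda>x. v t x $ j * h x) x * h x) (\<Sum>j\<in>(UNIV :: 'n set). 0)"
    by (intro has_bochner_integral_sum int_by_parts_has_integral assms)
  ultimately have "has_bochner_integral lborel (\<lambda>x. 2 * (\<Sum>j\<in>UNIV. v t x $ j * (h x * dx j h x))) 0"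
    by simp
  then have "has_bochner_integral lborel (\<lambda>x. 1/2 * (2 * (\<Sum>j\<in>UNIV. v t x $ j * (h x * dx j h x)))) (1/2 * 0)"
    by (intro has_bochner_integral_mult_right)
  then show ?thesis by simp
qed

lemma transport_null_vector:
  fixes h :: "real^'n \<Rightarrow> real^'m"
  assumes "0 \<le> t" "\<And>i j. int_by_parts j (\<lambda>x. v t x $ j * h x $ i) (\<lambda>x. h x $ i)"
    and h: "\<And>x. h differentiable (at x)"
  shows "has_bochner_integral lborel (\<lambda>x. \<Sum>j\<in>UNIV. v t x $ j * (h x \<bullet> dx j h x)) 0"
proof -
  have "has_bochner_integral lborel (\<lambda>x. \<Sum>i\<in>UNIV. \<Sum>j\<in>UNIV.
      v t x $ j * (h x $ i * dx j (\<lambda>x. h x $ i) x)) (\<Sum>i\<in>(UNIV :: 'm set). 0)"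
    using assms by (intro has_bochner_integral_sum transport_null_sq) (auto intro: differentiable_nth)
  moreover have "(\<Sum>i\<in>UNIV. \<Sum>j\<in>UNIV. v t x $ j * (h x $ i * dx j (\<lambda>x. h x $ i) x))
      = (\<Sum>j\<in>UNIV. v t x $ j * (h x \<bullet> dx j h x))" for x
    by (subst sum.swap) (simp add: dx_nth h inner_vec_def sum_distrib_left)
  ultimately show ?thesis by simp
qed

lemma transport_null_matrix:
  fixes h :: "real^'n \<Rightarrow> real^'n^'n"
  assumes "0 \<le> t" "\<And>k l j. int_by_parts j (\<lambda>x. v t x $ j * h x $ k $ l) (\<lambda>x. h x $ k $ l)"
    and h: "\<And>x. h differentiable (at x)"
  shows "has_bochner_integral lborel (\<lambda>x. \<Sum>j\<in>UNIV. v t x $ j * (h x \<bullet> dx j h x)) 0"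
proof -
  have "has_bochner_integral lborel (\<lambda>x. \<Sum>k\<in>UNIV. \<Sum>j\<in>UNIV.
      v t x $ j * (h x $ k \<bullet> dx j (\<lambda>x. h x $ k) x)) (\<Sum>k\<in>(UNIV :: 'n set). 0)"
    using assms by (intro has_bochner_integral_sum transport_null_vector) (auto intro: differentiable_bounded_linear[OF bounded_linear_vec_nth])
  moreover have "(\<Sum>k\<in>UNIV. \<Sum>j\<in>UNIV. v t x $ j * (h x $ k \<bullet> dx j (\<lambda>x. h x $ k) x))
      = (\<Sum>j\<in>UNIV. v t x $ j * (h x \<bullet> dx j h x))" for x
    by (subst sum.swap) (simp add: dx_bounded_linear[OF bounded_linear_vec_nth] h inner_vec_def sum_distrib_left)
  ultimately show ?thesis by simp
qed

lemma ibp: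
  assumes "0 \<le> t"
  shows "int_by_parts j (\<lambda>x. v t x $ j * v t x $ i) (\<lambda>x. v t x $ i)"
    "int_by_parts j (\<lambda>x. v t x $ j) (p t)"
    "int_by_parts j (\<lambda>x. v t x $ i) (\<lambda>x. dx j (v t) x $ i)"
    "int_by_parts j (\<lambda>x. v t x $ i) (\<lambda>x. stress1 L \<beta>1 \<beta>5 \<beta>6 v Q t x $ i $ j)"
    "int_by_parts j (\<lambda>x. v t x $ i) (\<lambda>x. stress2 \<mu>1 \<mu>2 v Q t x $ i $ j)"
    "int_by_parts j (\<lambda>x. v t x $ j * P t x $ k $ l) (\<lambda>x. P t x $ k $ l)"
    "int_by_parts j (\<lambda>x. P t x $ k $ l) (\<lambda>x. dx j (Q t) x $ k $ l)"
    "int_by_parts i (\<lambda>x. v t x $ i * dx j (Q t) x $ k $ l) (\<lambda>x. dx j (Q t) x $ k $ l)"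
    "int_by_parts j (\<lambda>x. v t x $ j) (\<lambda>x. psiB a b c (Q t x))"
    "int_by_parts j (\<lambda>x. v t x $ j * Q t x $ k $ l) (\<lambda>x. Q t x $ k $ l)"
  using decay assms by (simp_all add: decays_fast_def Let_def)

lemma densities:
  "good_density (\<lambda>t x. (norm (v t x))\<^sup>2)"
  "good_density (\<lambda>t x. tensor_sq (P t x))"
  "good_density (\<lambda>t x. grad_tensor_sq (Q t) x)"
  "good_density (\<lambda>t x. psiB a b c (Q t x))"
  "good_density (\<lambda>t x. trace (P t x ** Q t x))"
  "good_density (\<lambda>t x. tensor_sq (Q t x))"
  using decay by (simp_all add: decays_fast_def Let_def)

lemma integrable_densities:
  assumes "0 \<le> t"
  shows "integrable lborel (\<lambda>x. (norm (v t x))\<^sup>2)"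
    "integrable lborel (\<lambda>x. tensor_sq (P t x))"
    "integrable lborel (\<lambda>x. grad_tensor_sq (Q t) x)"
    "integrable lborel (\<lambda>x. psiB a b c (Q t x))"
    "integrable lborel (\<lambda>x. trace (P t x ** Q t x))"
    "integrable lborel (\<lambda>x. tensor_sq (Q t x))"
  using densities assms by (simp_all add: good_density_def)

lemma tensor_sq_eq: "0 \<le> t \<Longrightarrow> tensor_sq (Q t x) = Q t x \<bullet> Q t x"
  "0 \<le> t \<Longrightarrow> tensor_sq (P t x) = P t x \<bullet> P t x"
  by (simp_all add: tensor_sq_symmetric)

lemma grad_tensor_sq_eq: "grad_tensor_sq (Q t) x = (\<Sum>j\<in>UNIV. dx j (Q t) x \<bullet> dx j (Q t) x)"
proof -
  have "grad_tensor_sq (Q t) x = (\<Sum>i\<in>UNIV. \<Sum>k\<in>UNIV. \<Sum>j\<in>UNIV. (dx k (Q t) x $ i $ j)\<^sup>2)"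
    unfolding grad_tensor_sq_def by (intro sum.cong refl sum.swap)
  also have "\<dots> = (\<Sum>k\<in>UNIV. \<Sum>i\<in>UNIV. \<Sum>j\<in>UNIV. (dx k (Q t) x $ i $ j)\<^sup>2)"
    by (rule sum.swap)
  finally show ?thesis by (simp add: inner_matrix power2_eq_square)
qed

lemma grad_vec_sq_eq: "grad_vec_sq (v t) x = V t x \<bullet> V t x"
  by (simp add: grad_vec_sq_def inner_matrix V_def power2_eq_square)

text \<open>The alternative \<mu>2t = \<mu>2 is allowed only when both vanish, so the relation with
  the minus sign covers both cases.\<close>

lemma coeff_relations: "\<mu>2t = - \<mu>2" "\<beta>5 = - \<mu>2 / 2" "\<beta>6 = \<mu>2 / 2"
  using coeff by (auto simp: coeff_assms_def)

lemma coeff_pos: "0 < J" "0 < L" "0 < c" "0 \<le> \<beta>1" "0 \<le> \<beta>4" "0 \<le> \<mu>1"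
  using coeff by (auto simp: coeff_assms_def)

section \<open>The pointwise energy balance\<close>

definition dissipation where
  "dissipation t x = \<beta>4 / 2 * (V t x \<bullet> V t x) + \<beta>1 * (Q t x \<bullet> A t x)\<^sup>2
     + \<mu>1 * (N t x \<bullet> N t x) + \<mu>2 * (A t x \<bullet> N t x)"

definition stress where
  "stress t x = stress1 L \<beta>1 \<beta>5 \<beta>6 v Q t x + stress2 \<mu>1 \<mu>2 v Q t x"

text \<open>Each group is a sum of total derivatives when v is divergence-free. The companions added
  to the second-order terms, such as V:V or V:stress, are what integration by parts leaves
  behind.\<close>

definition null_lagrangian where
  "null_lagrangian t x =
     - (\<Sum>j\<in>UNIV. v t x $ j * (v t x \<bullet> dx j (v t) x))
     - (\<Sum>j\<in>UNIV. v t x $ j * dx j (p t) x)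
     + \<beta>4 / 2 * (v t x \<bullet> laplacian (v t) x + V t x \<bullet> V t x)
     + (v t x \<bullet> (div_mat (stress1 L \<beta>1 \<beta>5 \<beta>6 v Q t) x + div_mat (stress2 \<mu>1 \<mu>2 v Q t) x) + V t x \<bullet> stress t x)
     - J * (\<Sum>j\<in>UNIV. v t x $ j * (P t x \<bullet> dx j (P t) x))
     + L * (P t x \<bullet> laplacian (Q t) x + (\<Sum>j\<in>UNIV. dx j (P t) x \<bullet> dx j (Q t) x))
     - L * (\<Sum>j\<in>UNIV. \<Sum>i\<in>UNIV. v t x $ i * (dx j (Q t) x \<bullet> dx i (dx j (Q t)) x))
     - (\<Sum>j\<in>UNIV. v t x $ j * (bulk_force a b c (Q t x) \<bullet> dx j (Q t) x))"

lemma V_inner_grad_odot: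
  "V t x \<bullet> grad_odot (Q t) x = (\<Sum>j\<in>UNIV. \<Sum>i\<in>UNIV. (dx j (v t) x $ i) * (dx i (Q t) x \<bullet> dx j (Q t) x))"
proof -
  have "grad_odot (Q t) x $ i $ j = dx i (Q t) x \<bullet> dx j (Q t) x" for i j
    by (simp add: grad_odot_def inner_matrix)
  then show ?thesis
    unfolding inner_matrix[of "V t x"] by (simp add: V_def) (rule sum.swap)
qed

lemma V_inner_stress:
  fixes x :: "real^'n"
  assumes "0 \<le> t"
  defines "K \<equiv> comm (spin (v t) x) (Q t x)"
  shows "V t x \<bullet> stress t x = - L * (V t x \<bullet> grad_odot (Q t) x) + \<beta>1 * (Q t x \<bullet> A t x)\<^sup>2
    - \<mu>2 / 2 * (K \<bullet> A t x) + \<mu>2 / 2 * (A t x \<bullet> N t x) - \<mu>1 * (K \<bullet> N t x)"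
proof -
  let ?B = "(\<beta>1 * trace (Q t x ** A t x)) *\<^sub>R Q t x + (- \<mu>2 / 2) *\<^sub>R (A t x ** Q t x)
      + (\<mu>2 / 2) *\<^sub>R (Q t x ** A t x) + ((\<mu>2 / 2) *\<^sub>R N t x + \<mu>1 *\<^sub>R comm (Q t x) (N t x))"
  have "stress t x = (- L) *\<^sub>R grad_odot (Q t) x + ?B"
    unfolding stress_def stress1_def stress2_def by (simp only: coeff_relations add.assoc)
  then have "V t x \<bullet> stress t x = - L * (V t x \<bullet> grad_odot (Q t) x) + V t x \<bullet> ?B"
    by (simp only: inner_add_right[of _ _ ?B] inner_scaleR_right[of _ "- L"])
  also have "V t x \<bullet> ?B = \<beta>1 * (Q t x \<bullet> A t x)\<^sup>2 - \<mu>2 / 2 * (K \<bullet> A t x) + \<mu>2 / 2 * (A t x \<bullet> N t x)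
      - \<mu>1 * (K \<bullet> N t x)"
    unfolding K_def strain_eq spin_eq by (rule inner_stress[OF symmetric_fields(1) symmetric_fields(4)]) (rule assms)+
  finally show ?thesis by (simp only: add_diff_eq add.assoc)
qed

lemma momentum_energy:
  assumes "0 \<le> t"
  shows "v t x \<bullet> dt v t x = - (\<Sum>j\<in>UNIV. v t x $ j * (v t x \<bullet> dx j (v t) x))
     - (\<Sum>j\<in>UNIV. v t x $ j * dx j (p t) x) + \<beta>4 / 2 * (v t x \<bullet> laplacian (v t) x)
     + v t x \<bullet> (div_mat (stress1 L \<beta>1 \<beta>5 \<beta>6 v Q t) x + div_mat (stress2 \<mu>1 \<mu>2 v Q t) x)"
proof -
  let ?S = "div_mat (stress1 L \<beta>1 \<beta>5 \<beta>6 v Q t) x + div_mat (stress2 \<mu>1 \<mu>2 v Q t) x"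
  have "material v v t x + grad (p t) x - (\<beta>4 / 2) *\<^sub>R laplacian (v t) x = ?S"
    using solution assms unfolding qian_sheng_solution_def by blast
  then have "v t x \<bullet> (material v v t x + grad (p t) x - (\<beta>4 / 2) *\<^sub>R laplacian (v t) x) = v t x \<bullet> ?S"
    by simp
  moreover have "v t x \<bullet> grad (p t) x = (\<Sum>j\<in>UNIV. v t x $ j * dx j (p t) x)"
    by (simp add: inner_vec_def grad_def)
  moreover have "v t x \<bullet> material v v t x = v t x \<bullet> dt v t x + (\<Sum>j\<in>UNIV. v t x $ j * (v t x \<bullet> dx j (v t) x))"
    by (simp add: material_def inner_add_right inner_sum_right)
  ultimately show ?thesis
    by (simp only: inner_add_right inner_diff_right inner_scaleR_right)
qed

lemma tensor_energy:
  assumes "0 \<le> t"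
  shows "J * (P t x \<bullet> dt P t x) = - J * (\<Sum>j\<in>UNIV. v t x $ j * (P t x \<bullet> dx j (P t) x))
     + L * (P t x \<bullet> laplacian (Q t) x) - bulk_force a b c (Q t x) \<bullet> P t x
     - \<mu>1 * (N t x \<bullet> P t x) - \<mu>2 / 2 * (A t x \<bullet> P t x)"
proof -
  have Qeq: "J *\<^sub>R material v P t x + \<mu>1 *\<^sub>R P t x
          = L *\<^sub>R laplacian (Q t) x - a *\<^sub>R Q t x
            + b *\<^sub>R (Q t x ** Q t x - (tensor_sq (Q t x) / real CARD('n)) *\<^sub>R mat 1)
            - (c * tensor_sq (Q t x)) *\<^sub>R Q t x
            + (\<mu>2t / 2) *\<^sub>R A t x + \<mu>1 *\<^sub>R comm (spin (v t) x) (Q t x)"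
    using solution assms unfolding qian_sheng_solution_def by blast
  have "J *\<^sub>R material v P t x = L *\<^sub>R laplacian (Q t) x - bulk_force a b c (Q t x)
      - (b * (tensor_sq (Q t x) / real CARD('n))) *\<^sub>R mat 1 - (\<mu>2 / 2) *\<^sub>R A t x - \<mu>1 *\<^sub>R N t x"
    using Qeq assms
    by (simp add: bulk_force_def corot_def tensor_sq_eq coeff_relations algebra_simps)
  then have "P t x \<bullet> (J *\<^sub>R material v P t x) = P t x \<bullet> (L *\<^sub>R laplacian (Q t) x - bulk_force a b c (Q t x)
      - (b * (tensor_sq (Q t x) / real CARD('n))) *\<^sub>R mat 1 - (\<mu>2 / 2) *\<^sub>R A t x - \<mu>1 *\<^sub>R N t x)"
    by simp
  \<comment> \<open>This removes the term with b |Q|^2 / d, the projection to trace-free matrices in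
    the Q-equation.\<close>
  moreover have "P t x \<bullet> mat 1 = 0"
    using assms by (simp add: trace_eq_inner[symmetric])
  moreover have "P t x \<bullet> material v P t x = P t x \<bullet> dt P t x + (\<Sum>j\<in>UNIV. v t x $ j * (P t x \<bullet> dx j (P t) x))"
    unfolding material_def[of v P] by (simp add: inner_add_right inner_sum_right)
  ultimately show ?thesis
    by (simp add: inner_diff_right inner_commute algebra_simps)
qed

text \<open>The gradient does not commute with the material derivative: differentiating v_i d_i Q
  leaves (d_j v_i) d_i Q. Paired with d_j Q this is V : \<open>grad_odot\<close>, which the elastic
  stress is designed to balance.\<close>

lemma elastic_energy:
  assumes "0 \<le> t"
  shows "(\<Sum>j\<in>UNIV. dx j (Q t) x \<bullet> dx j (dt Q t) x) = (\<Sum>j\<in>UNIV. dx j (P t) x \<bullet> dx j (Q t) x)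
     - (\<Sum>j\<in>UNIV. \<Sum>i\<in>UNIV. v t x $ i * (dx j (Q t) x \<bullet> dx i (dx j (Q t)) x))
     - V t x \<bullet> grad_odot (Q t) x"
proof -
  have "dx j (P t) x \<bullet> dx j (Q t) x = dx j (Q t) x \<bullet> dx j (dt Q t) x
      + (\<Sum>i\<in>UNIV. v t x $ i * (dx j (Q t) x \<bullet> dx i (dx j (Q t)) x))
      + (\<Sum>i\<in>UNIV. (dx j (v t) x $ i) * (dx i (Q t) x \<bullet> dx j (Q t) x))" for j
    unfolding dx_P[OF assms] inner_add_left inner_sum_left inner_scaleR_left sum.distrib
      dx_dx_commute[OF C1(2) C1(4) assms, of j _ x]
    by (simp add: inner_commute)
  then show ?thesis
    by (simp add: V_inner_grad_odot sum.distrib)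
qed

lemma bulk_energy:
  "bulk_force a b c (Q t x) \<bullet> dt Q t x = bulk_force a b c (Q t x) \<bullet> P t x
     - (\<Sum>j\<in>UNIV. v t x $ j * (bulk_force a b c (Q t x) \<bullet> dx j (Q t) x))"
  by (simp add: P_eq inner_add_right inner_sum_right)

lemma energy_density_identity:
  assumes "0 \<le> t"
  shows "v t x \<bullet> dt v t x + J * (P t x \<bullet> dt P t x) + L * (\<Sum>j\<in>UNIV. dx j (Q t) x \<bullet> dx j (dt Q t) x)
      + bulk_force a b c (Q t x) \<bullet> dt Q t x = null_lagrangian t x - dissipation t x"
proof -
  let ?K = "comm (spin (v t) x) (Q t x)"
  have P: "P t x = N t x + ?K" by (simp add: corot_def)
  show ?thesis
    unfolding momentum_energy[OF assms] tensor_energy[OF assms] elastic_energy[OF assms] bulk_energy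
      null_lagrangian_def dissipation_def V_inner_stress[OF assms]
    \<comment> \<open>The splitting of P is applied only where P is paired with N or A. Elsewhere P
      must stay intact to match the transport and elastic terms of
      \<open>null_lagrangian\<close>.\<close>
    unfolding P[THEN arg_cong[where f = "\<lambda>y. N t x \<bullet> y"]] P[THEN arg_cong[where f = "\<lambda>y. A t x \<bullet> y"]]
    by (simp add: inner_add_right inner_commute algebra_simps)
qed

section \<open>Integration of the null terms\<close>

text \<open>The integrations by parts concern single entries of the stress, while
  \<open>div_mat\<close> differentiates the whole matrix field; differentiability of the field
  connects the two.\<close>

lemma differentiable_stress:
  assumes "0 \<le> t"
  shows "stress1 L \<beta>1 \<beta>5 \<beta>6 v Q t differentiable (at x)" "stress2 \<mu>1 \<mu>2 v Q t differentiable (at x)"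
proof -
  note mult = differentiable_bounded_bilinear[OF bounded_bilinear_matrix_mult]
  have A: "(\<lambda>x. A t x) differentiable (at x)"
    using assms by (intro differentiable_matrixI)
      (auto simp: strain_def intro!: differentiable_add differentiable_divide differentiable_nth)
  have W: "(\<lambda>x. spin (v t) x) differentiable (at x)"
    using assms by (intro differentiable_matrixI)
      (auto simp: spin_def intro!: differentiable_diff differentiable_divide differentiable_nth)
  have G: "(\<lambda>x. grad_odot (Q t) x) differentiable (at x)"
    using assms by (intro differentiable_matrixI)
      (auto simp: grad_odot_def intro!: differentiable_sum differentiable_mult differentiable_nth_nth)
  have Q: "Q t differentiable (at x)" and P: "P t differentiable (at x)"
    using assms by auto
  have N: "(\<lambda>x. N t x) differentiable (at x)"
    unfolding corot_def comm_def by (intro differentiable_diff mult P Q W)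
  have tr: "(\<lambda>x. trace (Q t x ** A t x)) differentiable (at x)"
    by (intro differentiable_bounded_linear[OF bounded_linear_trace] mult Q A)
  show "stress1 L \<beta>1 \<beta>5 \<beta>6 v Q t differentiable (at x)"
    unfolding stress1_def[abs_def]
    by (intro differentiable_add differentiable_scaleR differentiable_const differentiable_mult mult tr G A Q)
  show "stress2 \<mu>1 \<mu>2 v Q t differentiable (at x)"
    unfolding stress2_def[abs_def] comm_def
    by (intro differentiable_add differentiable_diff differentiable_scaleR differentiable_const mult N Q)
qed

lemma stress_null:
  assumes t: "0 \<le> t" and M: "\<And>x. M differentiable (at x)"
    and ibp: "\<And>i j. int_by_parts j (\<lambda>x. v t x $ i) (\<lambda>x. M x $ i $ j)"
  shows "has_bochner_integral lborel (\<lambda>x. v t x \<bullet> div_mat M x + V t x \<bullet> M x) 0"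
proof -
  have "has_bochner_integral lborel (\<lambda>x. \<Sum>i\<in>UNIV. \<Sum>j\<in>UNIV.
      v t x $ i * dx j (\<lambda>x. M x $ i $ j) x + dx j (\<lambda>x. v t x $ i) x * M x $ i $ j)
      (\<Sum>i\<in>(UNIV :: 'n set). \<Sum>j\<in>(UNIV :: 'n set). 0)"
    by (intro has_bochner_integral_sum int_by_parts_has_integral ibp)
  then show ?thesis
    using t by (simp add: dx_nth dx_nth_nth M sum.distrib inner_matrix V_def div_mat_def
        inner_vec_def[of "v t _"] sum_distrib_left)
qed

lemma viscous_null:
  assumes t: "0 \<le> t"
  shows "has_bochner_integral lborel (\<lambda>x. v t x \<bullet> laplacian (v t) x + V t x \<bullet> V t x) 0"
proof -
  have "has_bochner_integral lborel (\<lambda>x. \<Sum>i\<in>UNIV. \<Sum>j\<in>UNIV.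
      v t x $ i * dx j (\<lambda>x. dx j (v t) x $ i) x + dx j (\<lambda>x. v t x $ i) x * dx j (v t) x $ i)
      (\<Sum>i\<in>(UNIV :: 'n set). \<Sum>j\<in>(UNIV :: 'n set). 0)"
    by (intro has_bochner_integral_sum int_by_parts_has_integral ibp t)
  then show ?thesis
    using t by (simp add: dx_nth sum.distrib inner_matrix V_def laplacian_def
        inner_vec_def[of "v t _"] sum_distrib_left)
qed

text \<open>The squares of the entries of V occur as one of the two integrands in the viscous
  integration by parts, which carries their integrability.\<close>

lemma integrable_grad_v: "0 \<le> t \<Longrightarrow> integrable lborel (\<lambda>x. V t x \<bullet> V t x)"
proof -
  assume t: "0 \<le> t"
  have "integrable lborel (\<lambda>x. dx j (v t) x $ i * dx j (v t) x $ i)" for i j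
    using ibp(3)[OF t, of j i] t by (simp add: int_by_parts_def dx_nth)
  then show "integrable lborel (\<lambda>x. V t x \<bullet> V t x)"
    by (simp add: inner_matrix V_def)
qed

lemma elastic_null:
  assumes t: "0 \<le> t"
  shows "has_bochner_integral lborel
    (\<lambda>x. P t x \<bullet> laplacian (Q t) x + (\<Sum>j\<in>UNIV. dx j (P t) x \<bullet> dx j (Q t) x)) 0"
proof -
  have "has_bochner_integral lborel (\<lambda>x. \<Sum>j\<in>UNIV. \<Sum>k\<in>UNIV. \<Sum>l\<in>UNIV.
      P t x $ k $ l * dx j (\<lambda>x. dx j (Q t) x $ k $ l) x + dx j (\<lambda>x. P t x $ k $ l) x * dx j (Q t) x $ k $ l)
      (\<Sum>j\<in>(UNIV :: 'n set). \<Sum>k\<in>(UNIV :: 'n set). \<Sum>l\<in>(UNIV :: 'n set). 0)"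
    by (intro has_bochner_integral_sum int_by_parts_has_integral ibp t)
  moreover have "P t x \<bullet> laplacian (Q t) x = (\<Sum>j\<in>UNIV. \<Sum>k\<in>UNIV. \<Sum>l\<in>UNIV.
      P t x $ k $ l * dx j (dx j (Q t)) x $ k $ l)" for x
    unfolding laplacian_def inner_sum_right by (simp only: inner_matrix)
  ultimately show ?thesis
    using t by (simp add: dx_nth_nth sum.distrib inner_matrix)
qed

lemma bulk_null:
  assumes t: "0 \<le> t"
  shows "has_bochner_integral lborel
    (\<lambda>x. \<Sum>j\<in>UNIV. v t x $ j * (bulk_force a b c (Q t x) \<bullet> dx j (Q t) x)) 0"
proof -
  have "dx j (\<lambda>x. psiB a b c (Q t x)) x = bulk_force a b c (Q t x) \<bullet> dx j (Q t) x" for j x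
    using dx_eq[OF psiB_has_derivative[OF has_frechet_derivative[OF differentiable_fields(3)[OF t]]]] t
    by (simp add: dx_def)
  then show ?thesis using transport_null[OF t ibp(9)[OF t]] by simp
qed

lemma null_lagrangian_integral:
  assumes t: "0 \<le> t"
  shows "has_bochner_integral lborel (null_lagrangian t) 0"
proof -
  have S: "has_bochner_integral lborel
      (\<lambda>x. (v t x \<bullet> div_mat (stress1 L \<beta>1 \<beta>5 \<beta>6 v Q t) x + V t x \<bullet> stress1 L \<beta>1 \<beta>5 \<beta>6 v Q t x)
         + (v t x \<bullet> div_mat (stress2 \<mu>1 \<mu>2 v Q t) x + V t x \<bullet> stress2 \<mu>1 \<mu>2 v Q t x)) (0 + 0)"
    by (intro has_bochner_integral_add stress_null differentiable_stress ibp t)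
  have S': "has_bochner_integral lborel (\<lambda>x. v t x \<bullet> (div_mat (stress1 L \<beta>1 \<beta>5 \<beta>6 v Q t) x
      + div_mat (stress2 \<mu>1 \<mu>2 v Q t) x) + V t x \<bullet> stress t x) 0"
    using S by (simp add: stress_def inner_add_right algebra_simps)
  have D: "has_bochner_integral lborel
      (\<lambda>x. \<Sum>j\<in>UNIV. \<Sum>i\<in>UNIV. v t x $ i * (dx j (Q t) x \<bullet> dx i (dx j (Q t)) x)) (\<Sum>j\<in>(UNIV :: 'n set). 0)"
    by (intro has_bochner_integral_sum transport_null_matrix ibp t differentiable_fields)
  \<comment> \<open>The value is written as zeros in the shape of the definition, so that the
    linearity rules can split it term by term.\<close>
  have "has_bochner_integral lborel (null_lagrangian t)
      (- 0 - 0 + \<beta>4 / 2 * 0 + 0 - J * 0 + L * 0 - L * (\<Sum>j\<in>(UNIV :: 'n set). 0) - 0)"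
    unfolding null_lagrangian_def[abs_def]
    by (intro has_bochner_integral_add has_bochner_integral_diff has_bochner_integral_minus
        has_bochner_integral_mult_right transport_null transport_null_vector transport_null_matrix
        viscous_null elastic_null bulk_null S' D ibp t differentiable_fields diff_P)
  then show ?thesis by simp
qed

lemma density_derivatives:
  assumes t: "0 \<le> t"
  shows "((\<lambda>s. (norm (v s x))\<^sup>2) has_real_derivative 2 * (v t x \<bullet> dt v t x)) (at t within {0..})"
    "((\<lambda>s. tensor_sq (P s x)) has_real_derivative 2 * (P t x \<bullet> dt P t x)) (at t within {0..})"
    "((\<lambda>s. grad_tensor_sq (Q s) x) has_real_derivative
        2 * (\<Sum>j\<in>UNIV. dx j (Q t) x \<bullet> dx j (dt Q t) x)) (at t within {0..})"
    "((\<lambda>s. psiB a b c (Q s x)) has_real_derivative bulk_force a b c (Q t x) \<bullet> dt Q t x) (at t within {0..})"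
    "((\<lambda>s. tensor_sq (Q s x)) has_real_derivative 2 * (Q t x \<bullet> dt Q t x)) (at t within {0..})"
proof -
  have self: "((\<lambda>s. f s \<bullet> f s) has_real_derivative 2 * (f t \<bullet> f')) (at t within {0..})"
    if "(f has_vector_derivative f') (at t within {0..})" for f f' and t :: real
    using has_real_derivative_inner[OF that that] by (simp add: inner_commute)
  \<comment> \<open>\<open>tensor_sq\<close> is the trace of a square and agrees with the squared
    norm only for symmetric matrices, hence only at nonnegative times; the derivative is transferred
    within the half-line.\<close>
  have tensor: "((\<lambda>s. tensor_sq (f s)) has_real_derivative 2 * (f t \<bullet> f')) (at t within {0..})"
    if "(f has_vector_derivative f') (at t within {0..})" "\<And>s. 0 \<le> s \<Longrightarrow> transpose (f s) = f s"
    for f :: "real \<Rightarrow> real^'n^'n" and f'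
    using self[OF that(1)]
    by (rule has_field_derivative_transform_within[where d = 1])
      (use t that(2) in \<open>auto simp: tensor_sq_symmetric\<close>)
  show "((\<lambda>s. (norm (v s x))\<^sup>2) has_real_derivative 2 * (v t x \<bullet> dt v t x)) (at t within {0..})"
    unfolding power2_norm_eq_inner by (rule self[OF has_dt_v[OF t]])
  show "((\<lambda>s. tensor_sq (P s x)) has_real_derivative 2 * (P t x \<bullet> dt P t x)) (at t within {0..})"
    by (rule tensor[OF has_dt_P[OF t]]) simp
  show "((\<lambda>s. tensor_sq (Q s x)) has_real_derivative 2 * (Q t x \<bullet> dt Q t x)) (at t within {0..})"
    by (rule tensor[OF has_dt_Q[OF t]]) simp
  show "((\<lambda>s. grad_tensor_sq (Q s) x) has_real_derivative
      2 * (\<Sum>j\<in>UNIV. dx j (Q t) x \<bullet> dx j (dt Q t) x)) (at t within {0..})"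
    unfolding grad_tensor_sq_eq sum_distrib_left
    by (intro DERIV_sum self has_dt_dx_Q t)
  show "((\<lambda>s. psiB a b c (Q s x)) has_real_derivative bulk_force a b c (Q t x) \<bullet> dt Q t x) (at t within {0..})"
    using psiB_has_derivative[OF has_dt_Q[OF t, unfolded has_vector_derivative_def], of x] t
    by (simp add: has_field_derivative_def mult_commute_abs)
qed

text \<open>Integrability of the dissipation is read off from the energy identity: it is the null
  terms minus time derivatives of good densities. No separate integrability of N is at hand.\<close>

lemma energy_law:
  assumes t: "0 \<le> t"
  shows "integrable lborel (dissipation t)"
    and "(energy J L a b c v Q has_real_derivative - (LINT x|lborel. dissipation t x)) (at t within {0..})"
proof -
  note d1 = good_density_has_derivative[OF densities(1) density_derivatives(1) t]
    and d2 = good_density_has_derivative[OF densities(2) density_derivatives(2) t]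
    and d3 = good_density_has_derivative[OF densities(3) density_derivatives(3) t]
    and d4 = good_density_has_derivative[OF densities(4) density_derivatives(4) t]
  note null = null_lagrangian_integral[OF t, unfolded has_bochner_integral_iff]
  have diss: "dissipation t x = null_lagrangian t x - (1/2 * (2 * (v t x \<bullet> dt v t x) + J * (2 * (P t x \<bullet> dt P t x))
      + L * (2 * (\<Sum>j\<in>UNIV. dx j (Q t) x \<bullet> dx j (dt Q t) x))) + bulk_force a b c (Q t x) \<bullet> dt Q t x)" for x
    using energy_density_identity[OF t, of x] by (simp add: algebra_simps)
  show "integrable lborel (dissipation t)"
    unfolding diss[abs_def] using null d1(1) d2(1) d3(1) d4(1) by (intro Bochner_Integration.integrable_diff
      Bochner_Integration.integrable_add integrable_mult_right) auto
  have I: "(LINT x|lborel. dissipation t x) = 0 - (1/2 * ((LINT x|lborel. 2 * (v t x \<bullet> dt v t x))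
      + J * (LINT x|lborel. 2 * (P t x \<bullet> dt P t x))
      + L * (LINT x|lborel. 2 * (\<Sum>j\<in>UNIV. dx j (Q t) x \<bullet> dx j (dt Q t) x)))
      + (LINT x|lborel. bulk_force a b c (Q t x) \<bullet> dt Q t x))"
    unfolding diss using null d1(1) d2(1) d3(1) d4(1) by simp
  have E: "((\<lambda>s. 1/2 * ((LINT x|lborel. (norm (v s x))\<^sup>2) + J * (LINT x|lborel. tensor_sq (P s x))
      + L * (LINT x|lborel. grad_tensor_sq (Q s) x)) + (LINT x|lborel. psiB a b c (Q s x))) has_real_derivative
      1/2 * ((LINT x|lborel. 2 * (v t x \<bullet> dt v t x))
      + J * (LINT x|lborel. 2 * (P t x \<bullet> dt P t x))
      + L * (LINT x|lborel. 2 * (\<Sum>j\<in>UNIV. dx j (Q t) x \<bullet> dx j (dt Q t) x)))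
      + (LINT x|lborel. bulk_force a b c (Q t x) \<bullet> dt Q t x)) (at t within {0..})"
    by (intro DERIV_add DERIV_cmult d1(2) d2(2) d3(2) d4(2))
  have "((\<lambda>s. 1/2 * ((LINT x|lborel. (norm (v s x))\<^sup>2) + J * (LINT x|lborel. tensor_sq (P s x))
      + L * (LINT x|lborel. grad_tensor_sq (Q s) x)) + (LINT x|lborel. psiB a b c (Q s x))) has_real_derivative
      - (LINT x|lborel. dissipation t x)) (at t within {0..})"
    by (rule DERIV_cong[OF E]) (simp only: I diff_0 minus_minus)
  then show "(energy J L a b c v Q has_real_derivative - (LINT x|lborel. dissipation t x)) (at t within {0..})"
    by (rule has_field_derivative_transform_within[where d = 1])
      (use t integrable_densities in \<open>auto simp: energy_def\<close>)
qed

subsection \<open>A priori bounds\<close>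

abbreviation "\<epsilon> \<equiv> \<beta>4 / 2 - \<mu>2\<^sup>2 / (4 * \<mu>1)"

abbreviation "\<Lambda> \<equiv> coercivity_shift a b c"

text \<open>By Young's inequality 2 P:Q is at most |P|^2 + |Q|^2, and the integrals of these are at
  most 2/J and 2 times \<open>lyapunov\<close>.\<close>

abbreviation "growth \<equiv> \<Lambda> * (2 / J + 2)"

definition lyapunov where
  "lyapunov t = energy J L a b c v Q t + \<Lambda> * (LINT x|lborel. tensor_sq (Q t x))"

lemma dissipation_integral_ge:
  assumes "nondegenerate \<mu>1 \<mu>2" and t: "0 \<le> t"
  shows "\<epsilon> * (LINT x|lborel. V t x \<bullet> V t x) \<le> (LINT x|lborel. dissipation t x)"
proof -
  have "\<epsilon> * (V t x \<bullet> V t x) \<le> dissipation t x" for x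
    using dissipation_bound[of \<mu>1 \<mu>2 \<beta>4 "V t x" "N t x"] assms(1) coeff_pos(4,6)
    unfolding dissipation_def strain_eq nondegenerate_def
    by (smt (verit) mult_nonneg_nonneg zero_le_power2)
  then have "(LINT x|lborel. \<epsilon> * (V t x \<bullet> V t x)) \<le> (LINT x|lborel. dissipation t x)"
    by (intro integral_mono integrable_mult_right integrable_grad_v energy_law t)
  then show ?thesis by simp
qed

text \<open>Transport of |Q|^2 integrates to zero, so \<open>dt Q\<close> may be replaced by P,
  which the energy controls.\<close>

lemma tensor_integral_has_derivative:
  assumes t: "0 \<le> t"
  shows "((\<lambda>s. LINT x|lborel. tensor_sq (Q s x)) has_real_derivative
      2 * (LINT x|lborel. trace (P t x ** Q t x))) (at t within {0..})"
proof -
  have null: "has_bochner_integral lborel (\<lambda>x. \<Sum>j\<in>UNIV. v t x $ j * (Q t x \<bullet> dx j (Q t) x)) 0"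
    by (intro transport_null_matrix ibp t differentiable_fields)
  have "2 * (Q t x \<bullet> dt Q t x) = 2 * trace (P t x ** Q t x) - 2 * (\<Sum>j\<in>UNIV. v t x $ j * (Q t x \<bullet> dx j (Q t) x))" for x
  proof -
    have "trace (P t x ** Q t x) = Q t x \<bullet> P t x"
      using t by (simp add: trace_matrix_mult inner_commute)
    then show ?thesis
      by (simp add: P_eq inner_add_right inner_sum_right)
  qed
  then have "(LINT x|lborel. 2 * (Q t x \<bullet> dt Q t x)) = 2 * (LINT x|lborel. trace (P t x ** Q t x))"
    using null integrable_densities(5)[OF t] by (simp add: has_bochner_integral_iff)
  with good_density_has_derivative(2)[OF densities(6) density_derivatives(5) t]
  show ?thesis by simp
qed

lemma coercivity_shift_nonneg: "0 \<le> \<Lambda>"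
  using coeff_pos(3) by (simp add: coercivity_shift_def)

lemma growth_nonneg: "0 \<le> growth"
  using coercivity_shift_nonneg coeff_pos(1) by simp

lemma grad_tensor_sq_nonneg: "0 \<le> grad_tensor_sq (Q t) x"
  unfolding grad_tensor_sq_eq by (intro sum_nonneg inner_ge_zero)

lemma integrals_nonneg:
  assumes "0 \<le> t"
  shows "0 \<le> (LINT x|lborel. (norm (v t x))\<^sup>2)" "0 \<le> (LINT x|lborel. tensor_sq (P t x))"
    "0 \<le> (LINT x|lborel. grad_tensor_sq (Q t) x)" "0 \<le> (LINT x|lborel. tensor_sq (Q t x))"
    "0 \<le> (LINT x|lborel. V t x \<bullet> V t x)"
  using assms by (auto intro!: integral_nonneg_AE AE_I2 grad_tensor_sq_nonneg simp: tensor_sq_eq)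

lemma lyapunov_coercive:
  assumes t: "0 \<le> t"
  shows "1/2 * (LINT x|lborel. (norm (v t x))\<^sup>2) + J/2 * (LINT x|lborel. tensor_sq (P t x))
      + L/2 * (LINT x|lborel. grad_tensor_sq (Q t) x) + 1/2 * (LINT x|lborel. tensor_sq (Q t x))
      \<le> lyapunov t"
proof -
  note int = integrable_densities[OF t]
  have "(LINT x|lborel. 1/2 * tensor_sq (Q t x)) \<le> (LINT x|lborel. psiB a b c (Q t x) + \<Lambda> * tensor_sq (Q t x))"
  proof (rule integral_mono)
    show "1/2 * tensor_sq (Q t x) \<le> psiB a b c (Q t x) + \<Lambda> * tensor_sq (Q t x)" for x
      using psiB_lower_bound[OF symmetric_fields(1)[OF t] coeff_pos(3), of x a b] t
      by (simp only: coercivity_shift_def tensor_sq_eq)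
  qed (use int in auto)
  then have "1/2 * (LINT x|lborel. tensor_sq (Q t x))
      \<le> (LINT x|lborel. psiB a b c (Q t x)) + \<Lambda> * (LINT x|lborel. tensor_sq (Q t x))"
    using int by simp
  moreover have "energy J L a b c v Q t = 1/2 * ((LINT x|lborel. (norm (v t x))\<^sup>2)
      + J * (LINT x|lborel. tensor_sq (P t x)) + L * (LINT x|lborel. grad_tensor_sq (Q t) x))
      + (LINT x|lborel. psiB a b c (Q t x))"
    unfolding energy_def using int by simp
  ultimately show ?thesis
    unfolding lyapunov_def by (simp add: algebra_simps)
qed

lemma lyapunov_bounds:
  assumes t: "0 \<le> t"
  shows "0 \<le> lyapunov t" "(LINT x|lborel. (norm (v t x))\<^sup>2) \<le> 2 * lyapunov t"
    "(LINT x|lborel. tensor_sq (P t x)) \<le> 2 / J * lyapunov t"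
    "(LINT x|lborel. grad_tensor_sq (Q t) x) \<le> 2 / L * lyapunov t"
    "(LINT x|lborel. tensor_sq (Q t x)) \<le> 2 * lyapunov t"
proof -
  note nn = integrals_nonneg[OF t]
  note pos = mult_nonneg_nonneg[OF less_imp_le[OF coeff_pos(1)] nn(2)]
    mult_nonneg_nonneg[OF less_imp_le[OF coeff_pos(2)] nn(3)]
  note low = lyapunov_coercive[OF t]
  show "0 \<le> lyapunov t" "(LINT x|lborel. (norm (v t x))\<^sup>2) \<le> 2 * lyapunov t"
    "(LINT x|lborel. tensor_sq (Q t x)) \<le> 2 * lyapunov t"
    using low nn pos by linarith+
  have "J * (LINT x|lborel. tensor_sq (P t x)) \<le> 2 * lyapunov t"
    "L * (LINT x|lborel. grad_tensor_sq (Q t) x) \<le> 2 * lyapunov t"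
    using low nn pos by linarith+
  then show "(LINT x|lborel. tensor_sq (P t x)) \<le> 2 / J * lyapunov t"
    "(LINT x|lborel. grad_tensor_sq (Q t) x) \<le> 2 / L * lyapunov t"
    using coeff_pos(1,2) by (simp_all add: field_simps)
qed

definition lyapunov_rate where
  "lyapunov_rate t = - (LINT x|lborel. dissipation t x) + \<Lambda> * (2 * (LINT x|lborel. trace (P t x ** Q t x)))"

lemma lyapunov_has_derivative:
  "0 \<le> t \<Longrightarrow> (lyapunov has_real_derivative lyapunov_rate t) (at t within {0..})"
  unfolding lyapunov_def[abs_def] lyapunov_rate_def
  by (intro DERIV_add DERIV_cmult energy_law tensor_integral_has_derivative)

lemma lyapunov_rate_le:
  assumes "nondegenerate \<mu>1 \<mu>2" and t: "0 \<le> t"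
  shows "lyapunov_rate t \<le> growth * lyapunov t - \<epsilon> * (LINT x|lborel. V t x \<bullet> V t x)"
proof -
  note int = integrable_densities[OF t]
  have "2 * trace (P t x ** Q t x) \<le> tensor_sq (P t x) + tensor_sq (Q t x)" for x
    using inner_ge_zero[of "P t x - Q t x"] t
    by (simp add: trace_matrix_mult tensor_sq_eq inner_diff_left inner_diff_right inner_commute)
  then have "(LINT x|lborel. 2 * trace (P t x ** Q t x)) \<le> (LINT x|lborel. tensor_sq (P t x) + tensor_sq (Q t x))"
    using int by (intro integral_mono) auto
  also have "\<dots> \<le> 2 / J * lyapunov t + 2 * lyapunov t"
    using int lyapunov_bounds[OF t] by simp
  also have "\<dots> = (2 / J + 2) * lyapunov t" by (simp add: distrib_right)
  finally have "\<Lambda> * (2 * (LINT x|lborel. trace (P t x ** Q t x))) \<le> \<Lambda> * ((2 / J + 2) * lyapunov t)"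
    using coercivity_shift_nonneg by (intro mult_left_mono) auto
  then show ?thesis
    using dissipation_integral_ge[OF assms] by (simp add: lyapunov_rate_def mult.assoc)
qed

text \<open>The bound is a sum of nonnegative numbers, one for each norm, so each norm is estimated
  by its own summand.\<close>

lemma star_bound:
  assumes nd: "nondegenerate \<mu>1 \<mu>2" and \<beta>4: "\<beta>4 > \<mu>2\<^sup>2 / (2 * \<mu>1)" and T: "0 < T"
    and M: "energy J L a b c v Q 0 \<le> M" "(LINT x|lborel. tensor_sq (Q 0 x)) \<le> M"
  defines "B \<equiv> exp (growth * T) * (M + \<Lambda> * M)"
  shows "star_bound T (2 * B + (2 * B + 2 / L * B) + 2 / J * B + ((B + growth * B * T) / \<epsilon> + 2 * B * T)) v Q"
    (is "star_bound T ?K v Q")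
proof -
  have eps: "0 < \<epsilon>" using \<beta>4 by (simp add: field_simps)
  have initial: "lyapunov 0 \<le> M + \<Lambda> * M"
    unfolding lyapunov_def using M coercivity_shift_nonneg by (intro add_mono mult_left_mono)
  have B: "lyapunov t \<le> B" if t: "0 \<le> t" "t \<le> T" for t
  proof -
    have "lyapunov_rate s \<le> growth * lyapunov s" if "0 \<le> s" for s
      using lyapunov_rate_le[OF nd that] mult_nonneg_nonneg[OF less_imp_le[OF eps] integrals_nonneg(5)[OF that]]
      by linarith
    then have "lyapunov t \<le> exp (growth * t) * lyapunov 0"
      by (intro gronwall_exp[OF lyapunov_has_derivative _ t(1)])
    also have "\<dots> \<le> B"
      unfolding B_def using t initial lyapunov_bounds(1)[of 0] growth_nonneg
      by (intro mult_mono) (auto intro: mult_left_mono)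
    finally show ?thesis .
  qed
  \<comment> \<open>\<open>M\<close> may have any sign; \<open>B\<close> is nonnegative because it
    dominates \<open>lyapunov 0\<close>.\<close>
  have B0: "0 \<le> B" using B[of 0] lyapunov_bounds(1)[of 0] T by simp
  have nn: "0 \<le> 2 / L * B" "0 \<le> 2 / J * B" "0 \<le> (B + growth * B * T) / \<epsilon> + 2 * B * T"
    using B0 coeff_pos(1,2) growth_nonneg eps T by auto
  have nn_int: "(\<integral>\<^sup>+x. ennreal (f x) \<partial>lborel) = ennreal (LINT x|lborel. f x)"
    if "integrable lborel f" "\<And>x. 0 \<le> f x" for f :: "real^'n \<Rightarrow> real"
    using that by (intro nn_integral_eq_integral) auto
  have v_le: "(LINT x|lborel. (norm (v t x))\<^sup>2) \<le> 2 * B" if "t \<in> {0..T}" for t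
    using lyapunov_bounds(2)[of t] B[of t] that by auto
  have "(\<integral>\<^sup>+x. ennreal ((norm (v t x))\<^sup>2) \<partial>lborel) \<le> ennreal ?K
      \<and> (\<integral>\<^sup>+x. ennreal (tensor_sq (Q t x) + grad_tensor_sq (Q t) x) \<partial>lborel) \<le> ennreal ?K
      \<and> (\<integral>\<^sup>+x. ennreal (tensor_sq (P t x)) \<partial>lborel) \<le> ennreal ?K" if tT: "t \<in> {0..T}" for t
  proof -
    have t: "0 \<le> t" "t \<le> T" using tT by auto
    note int = integrable_densities[OF t(1)]
    have le: "(LINT x|lborel. tensor_sq (Q t x)) \<le> 2 * B"
      "(LINT x|lborel. grad_tensor_sq (Q t) x) \<le> 2 / L * B"
      "(LINT x|lborel. tensor_sq (P t x)) \<le> 2 / J * B"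
      using order_trans[OF lyapunov_bounds(5)[OF t(1)] mult_left_mono[OF B[OF t]]]
        order_trans[OF lyapunov_bounds(4)[OF t(1)] mult_left_mono[OF B[OF t]]]
        order_trans[OF lyapunov_bounds(3)[OF t(1)] mult_left_mono[OF B[OF t]]] coeff_pos(1,2)
      by auto
    have "(\<integral>\<^sup>+x. ennreal ((norm (v t x))\<^sup>2) \<partial>lborel) = ennreal (LINT x|lborel. (norm (v t x))\<^sup>2)"
      by (rule nn_int[OF int(1)]) simp
    also have "\<dots> \<le> ennreal ?K"
      using v_le[OF tT] nn B0 by (intro ennreal_leI) linarith
    finally have "(\<integral>\<^sup>+x. ennreal ((norm (v t x))\<^sup>2) \<partial>lborel) \<le> ennreal ?K" .
    moreover have "(\<integral>\<^sup>+x. ennreal (tensor_sq (Q t x) + grad_tensor_sq (Q t) x) \<partial>lborel) \<le> ennreal ?K"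
    proof -
      have "0 \<le> tensor_sq (Q t x) + grad_tensor_sq (Q t) x" for x
        using grad_tensor_sq_nonneg[of t x] t by (simp add: tensor_sq_eq)
      then have "(\<integral>\<^sup>+x. ennreal (tensor_sq (Q t x) + grad_tensor_sq (Q t) x) \<partial>lborel)
          = ennreal ((LINT x|lborel. tensor_sq (Q t x)) + (LINT x|lborel. grad_tensor_sq (Q t) x))"
        using int by (subst nn_int) auto
      also have "\<dots> \<le> ennreal ?K"
        using le nn B0 by (intro ennreal_leI) linarith
      finally show ?thesis .
    qed
    moreover have "(\<integral>\<^sup>+x. ennreal (tensor_sq (P t x)) \<partial>lborel) \<le> ennreal ?K"
    proof -
      have "(\<integral>\<^sup>+x. ennreal (tensor_sq (P t x)) \<partial>lborel) = ennreal (LINT x|lborel. tensor_sq (P t x))"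
        using t by (intro nn_int[OF int(2)]) (simp add: tensor_sq_eq)
      also have "\<dots> \<le> ennreal ?K"
        using le nn B0 by (intro ennreal_leI) linarith
      finally show ?thesis .
    qed
    ultimately show ?thesis by blast
  qed
  moreover have "(\<integral>\<^sup>+t\<in>{0..T}. (\<integral>\<^sup>+x. ennreal ((norm (v t x))\<^sup>2 + grad_vec_sq (v t) x) \<partial>lborel) \<partial>lborel) \<le> ennreal ?K"
  proof -
    let ?g = "\<lambda>t. LINT x|lborel. V t x \<bullet> V t x"
    \<comment> \<open>The linear correction is chosen so that the derivative of \<open>- ?H\<close>
      is (growth B - rate)/\<epsilon> + 2B. The first part dominates the integral of |V|^2, the
      second that of |v|^2.\<close>
    let ?H = "\<lambda>t. lyapunov t / \<epsilon> - (growth * B / \<epsilon> + 2 * B) * t"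
    have "(\<integral>\<^sup>+t\<in>{0..T}. (\<integral>\<^sup>+x. ennreal ((norm (v t x))\<^sup>2 + grad_vec_sq (v t) x) \<partial>lborel) \<partial>lborel)
        \<le> (\<integral>\<^sup>+t\<in>{0..T}. ennreal (2 * B + ?g t) \<partial>lborel)"
    proof (rule set_nn_integral_mono)
      fix t assume tT: "t \<in> {0..T}"
      then have t: "0 \<le> t" by simp
      have "(\<integral>\<^sup>+x. ennreal ((norm (v t x))\<^sup>2 + grad_vec_sq (v t) x) \<partial>lborel)
          = ennreal ((LINT x|lborel. (norm (v t x))\<^sup>2) + ?g t)"
        using integrable_densities(1)[OF t] integrable_grad_v[OF t]
        by (subst nn_int) (auto simp: grad_vec_sq_eq)
      also have "\<dots> \<le> ennreal (2 * B + ?g t)"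
        using v_le[OF tT] by (intro ennreal_leI) simp
      finally show "(\<integral>\<^sup>+x. ennreal ((norm (v t x))\<^sup>2 + grad_vec_sq (v t) x) \<partial>lborel) \<le> ennreal (2 * B + ?g t)" .
    qed
    also have "\<dots> \<le> ennreal (?H 0 - ?H T)"
    proof (rule nn_integral_dissipation_le)
      show "(?H has_real_derivative lyapunov_rate t / \<epsilon> - (growth * B / \<epsilon> + 2 * B) * 1) (at t within {0..})"
        if "0 \<le> t" "t \<le> T" for t
        by (intro DERIV_diff DERIV_cdivide DERIV_cmult lyapunov_has_derivative that DERIV_ident)
      show "0 \<le> 2 * B + ?g t \<and> 2 * B + ?g t \<le> - (lyapunov_rate t / \<epsilon> - (growth * B / \<epsilon> + 2 * B) * 1)"
        if t: "0 \<le> t" "t \<le> T" for t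
      proof
        have "growth * lyapunov t \<le> growth * B"
          using B[OF t] growth_nonneg by (rule mult_left_mono)
        then have "\<epsilon> * ?g t \<le> growth * B - lyapunov_rate t"
          using lyapunov_rate_le[OF nd t(1)] by linarith
        then have "?g t \<le> (growth * B - lyapunov_rate t) / \<epsilon>"
          using eps by (subst pos_le_divide_eq) (auto simp: mult.commute)
        then show "2 * B + ?g t \<le> - (lyapunov_rate t / \<epsilon> - (growth * B / \<epsilon> + 2 * B) * 1)"
          by (simp add: diff_divide_distrib)
      qed (use B0 integrals_nonneg(5)[OF t(1)] in simp)
    qed (use T in simp)
    also have "?H 0 - ?H T \<le> (B + growth * B * T) / \<epsilon> + 2 * B * T"
    proof -
      have "lyapunov 0 / \<epsilon> \<le> B / \<epsilon>" "0 \<le> lyapunov T / \<epsilon>"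
        using B[of 0] lyapunov_bounds(1)[of T] T eps by (auto intro: divide_right_mono)
      then show ?thesis by (simp add: add_divide_distrib distrib_right)
    qed
    also have "\<dots> \<le> ?K" using nn B0 by linarith
    finally show ?thesis by (auto simp: ennreal_leI)
  qed
  ultimately show ?thesis unfolding star_bound_def by blast
qed

end

section \<open>Thresholds and constants uniform in the solution\<close>

lemma energy_decays:
  assumes "coeff_assms J L c \<beta>1 \<beta>4 \<beta>5 \<beta>6 \<mu>1 \<mu>2 \<mu>2t" "nondegenerate \<mu>1 \<mu>2" "\<beta>4 > \<mu>2\<^sup>2 / (2 * \<mu>1)"
    and "qian_sheng_solution J L a b c \<beta>1 \<beta>4 \<beta>5 \<beta>6 \<mu>1 \<mu>2 \<mu>2t v p Q"
    and "decays_fast L a b c \<beta>1 \<beta>5 \<beta>6 \<mu>1 \<mu>2 v p Q" and t: "0 \<le> t"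
  shows "\<exists>D\<le>0. (energy J L a b c v Q has_real_derivative D) (at t within {0..})"
proof -
  interpret qs_solution J L a b c \<beta>1 \<beta>4 \<beta>5 \<beta>6 \<mu>1 \<mu>2 \<mu>2t v p Q
    by (rule qs_solution.intro) (fact assms)+
  have "0 \<le> \<epsilon> * (LINT x|lborel. V t x \<bullet> V t x)"
    using assms(3) integrals_nonneg(5)[OF t] by (intro mult_nonneg_nonneg) (simp_all add: field_simps)
  then show ?thesis
    using dissipation_integral_ge[OF assms(2) t] energy_law(2)[OF t] by (intro exI conjI) auto
qed

lemma apriori_bounds_if_viscous:
  assumes coeff: "coeff_assms J L c \<beta>1 \<beta>4 \<beta>5 \<beta>6 \<mu>1 \<mu>2 \<mu>2t"
    and nd: "nondegenerate \<mu>1 \<mu>2" and \<beta>4: "\<beta>4 > \<mu>2\<^sup>2 / (2 * \<mu>1)"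
  shows "apriori_bounds TYPE('n::finite) J L a b c \<beta>1 \<beta>4 \<beta>5 \<beta>6 \<mu>1 \<mu>2 \<mu>2t"
  unfolding apriori_bounds_def
proof (intro allI impI exI, elim conjE)
  fix T M :: real and v :: "real \<Rightarrow> real^'n \<Rightarrow> real^'n" and p Q
  assume T: "0 < T" and sol: "qian_sheng_solution J L a b c \<beta>1 \<beta>4 \<beta>5 \<beta>6 \<mu>1 \<mu>2 \<mu>2t v p Q"
    and decay: "decays_fast L a b c \<beta>1 \<beta>5 \<beta>6 \<mu>1 \<mu>2 v p Q"
    and M: "energy J L a b c v Q 0 \<le> M" "(LINT x|lborel. tensor_sq (Q 0 x)) \<le> M"
  interpret qs_solution J L a b c \<beta>1 \<beta>4 \<beta>5 \<beta>6 \<mu>1 \<mu>2 \<mu>2t v p Q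
    by (rule qs_solution.intro[OF sol decay coeff])
  \<comment> \<open>The witness for \<open>K\<close> is fixed before the solution, so it is spelled
    out in the coefficients, \<open>T\<close> and \<open>M\<close>; the abbreviations of the locale
    unfold to the same term.\<close>
  show "star_bound T
      (let \<Lambda> = coercivity_shift a b c; growth = \<Lambda> * (2 / J + 2); \<epsilon> = \<beta>4 / 2 - \<mu>2\<^sup>2 / (4 * \<mu>1);
           B = exp (growth * T) * (M + \<Lambda> * M)
       in 2 * B + (2 * B + 2 / L * B) + 2 / J * B + ((B + growth * B * T) / \<epsilon> + 2 * B * T)) v Q"
    unfolding Let_def by (rule star_bound[OF nd \<beta>4 T M])
qed

theorem theorem1p1:
  assumes "CARD('n::finite) = 2 \<or> CARD('n) = 3"
  shows
    "(\<exists>Cd :: real \<Rightarrow> real \<Rightarrow> real \<Rightarrow> real \<Rightarrow> real \<Rightarrow> real.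
        \<forall>J L a b c \<beta>1 \<beta>4 \<beta>5 \<beta>6 \<mu>1 \<mu>2 \<mu>2t.
          coeff_assms J L c \<beta>1 \<beta>4 \<beta>5 \<beta>6 \<mu>1 \<mu>2 \<mu>2t \<and> nondegenerate \<mu>1 \<mu>2
          \<and> \<beta>4 > Cd \<mu>2t \<beta>5 \<beta>6 \<mu>2 \<mu>1 \<longrightarrow>
            (\<forall>(v :: real \<Rightarrow> real^'n \<Rightarrow> real^'n) p Q.
               qian_sheng_solution J L a b c \<beta>1 \<beta>4 \<beta>5 \<beta>6 \<mu>1 \<mu>2 \<mu>2t v p Q
               \<and> decays_fast L a b c \<beta>1 \<beta>5 \<beta>6 \<mu>1 \<mu>2 v p Q \<longrightarrow>
                 (\<forall>t\<ge>0. \<exists>D\<le>0. (energy J L a b c v Q has_real_derivative D) (at t within {0..})))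
            \<and> (CARD('n) = 2 \<and> a \<ge> 0 \<longrightarrow>
                 apriori_bounds TYPE('n) J L a b c \<beta>1 \<beta>4 \<beta>5 \<beta>6 \<mu>1 \<mu>2 \<mu>2t))
     \<and> (CARD('n) = 2 \<longrightarrow>
          (\<forall>a b c. a \<ge> 0 \<and> c > 0 \<longrightarrow> (\<forall>q \<in> (S0 :: (real^'n^'n) set). psiB a b c q \<ge> 0)))
     \<and> (CARD('n) = 2 \<longrightarrow>
          (\<forall>a b c. a < 0 \<and> c > 0 \<longrightarrow> (\<exists>q \<in> (S0 :: (real^'n^'n) set). psiB a b c q < 0)))
     \<and> (CARD('n) = 3 \<longrightarrow>
          (\<forall>a c. c > 0 \<longrightarrow> (\<exists>b. \<exists>q \<in> (S0 :: (real^'n^'n) set). psiB a b c q < 0)))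
     \<and> (\<exists>(\<mu>bar :: real \<Rightarrow> real \<Rightarrow> real \<Rightarrow> real) (J0 :: real \<Rightarrow> real \<Rightarrow> real \<Rightarrow> real \<Rightarrow> real)
          (Ct :: real \<Rightarrow> real \<Rightarrow> real \<Rightarrow> real \<Rightarrow> real).
          (\<forall>a b c. J0 (\<mu>bar a b c) a b c > 0)
          \<and> (\<forall>\<mu>2t \<beta>5 \<beta>6 \<mu>2. Ct \<mu>2t \<beta>5 \<beta>6 \<mu>2 > 0)
          \<and> (\<forall>J L a b c \<beta>1 \<beta>4 \<beta>5 \<beta>6 \<mu>1 \<mu>2 \<mu>2t.
               coeff_assms J L c \<beta>1 \<beta>4 \<beta>5 \<beta>6 \<mu>1 \<mu>2 \<mu>2t
               \<and> (CARD('n) = 2 \<and> a < 0 \<or> CARD('n) = 3)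
               \<and> J < J0 (\<mu>bar a b c) a b c \<and> \<mu>1 > \<mu>bar a b c \<and> \<beta>4 > Ct \<mu>2t \<beta>5 \<beta>6 \<mu>2 \<longrightarrow>
                 apriori_bounds TYPE('n) J L a b c \<beta>1 \<beta>4 \<beta>5 \<beta>6 \<mu>1 \<mu>2 \<mu>2t))"
proof (intro conjI)
  show "\<exists>Cd :: real \<Rightarrow> real \<Rightarrow> real \<Rightarrow> real \<Rightarrow> real \<Rightarrow> real.
        \<forall>J L a b c \<beta>1 \<beta>4 \<beta>5 \<beta>6 \<mu>1 \<mu>2 \<mu>2t.
          coeff_assms J L c \<beta>1 \<beta>4 \<beta>5 \<beta>6 \<mu>1 \<mu>2 \<mu>2t \<and> nondegenerate \<mu>1 \<mu>2
          \<and> \<beta>4 > Cd \<mu>2t \<beta>5 \<beta>6 \<mu>2 \<mu>1 \<longrightarrow>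
            (\<forall>(v :: real \<Rightarrow> real^'n \<Rightarrow> real^'n) p Q.
               qian_sheng_solution J L a b c \<beta>1 \<beta>4 \<beta>5 \<beta>6 \<mu>1 \<mu>2 \<mu>2t v p Q
               \<and> decays_fast L a b c \<beta>1 \<beta>5 \<beta>6 \<mu>1 \<mu>2 v p Q \<longrightarrow>
                 (\<forall>t\<ge>0. \<exists>D\<le>0. (energy J L a b c v Q has_real_derivative D) (at t within {0..})))
            \<and> (CARD('n) = 2 \<and> a \<ge> 0 \<longrightarrow>
                 apriori_bounds TYPE('n) J L a b c \<beta>1 \<beta>4 \<beta>5 \<beta>6 \<mu>1 \<mu>2 \<mu>2t)"
    \<comment> \<open>This threshold says exactly that \<open>\<beta>4 / 2\<close> exceeds
      \<open>\<mu>2\<^sup>2 / (4 * \<mu>1)\<close>. If \<mu>1 = 0, then \<mu>2 = 0 by nondegeneracy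
      and the quotient is 0.\<close>
    by (rule exI[of _ "\<lambda>\<mu>2t \<beta>5 \<beta>6 \<mu>2 \<mu>1. \<mu>2\<^sup>2 / (2 * \<mu>1)"])
      (intro allI impI conjI; elim conjE; intro energy_decays apriori_bounds_if_viscous; assumption)
next
  \<comment> \<open>Taking 1 as lower bound for \<mu>1 frees the threshold from \<mu>1; the summand
    1 keeps it positive when \<mu>2 = 0.\<close>
  have weaker: "\<mu>2\<^sup>2 / (2 * \<mu>1) \<le> \<mu>2\<^sup>2 / 2 + 1" if "1 < \<mu>1" for \<mu>1 \<mu>2 :: real
  proof -
    have "\<mu>2\<^sup>2 / (2 * \<mu>1) \<le> \<mu>2\<^sup>2 / 2" using that by (intro divide_left_mono) auto
    then show ?thesis by simp
  qed
  show "\<exists>(\<mu>bar :: real \<Rightarrow> real \<Rightarrow> real \<Rightarrow> real) (J0 :: real \<Rightarrow> real \<Rightarrow> real \<Rightarrow> real \<Rightarrow> real)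
          (Ct :: real \<Rightarrow> real \<Rightarrow> real \<Rightarrow> real \<Rightarrow> real).
          (\<forall>a b c. J0 (\<mu>bar a b c) a b c > 0)
          \<and> (\<forall>\<mu>2t \<beta>5 \<beta>6 \<mu>2. Ct \<mu>2t \<beta>5 \<beta>6 \<mu>2 > 0)
          \<and> (\<forall>J L a b c \<beta>1 \<beta>4 \<beta>5 \<beta>6 \<mu>1 \<mu>2 \<mu>2t.
               coeff_assms J L c \<beta>1 \<beta>4 \<beta>5 \<beta>6 \<mu>1 \<mu>2 \<mu>2t
               \<and> (CARD('n) = 2 \<and> a < 0 \<or> CARD('n) = 3)
               \<and> J < J0 (\<mu>bar a b c) a b c \<and> \<mu>1 > \<mu>bar a b c \<and> \<beta>4 > Ct \<mu>2t \<beta>5 \<beta>6 \<mu>2 \<longrightarrow>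
                 apriori_bounds TYPE('n) J L a b c \<beta>1 \<beta>4 \<beta>5 \<beta>6 \<mu>1 \<mu>2 \<mu>2t)"
  proof (intro exI conjI allI impI)
    fix J L a b c \<beta>1 \<beta>4 \<beta>5 \<beta>6 \<mu>1 \<mu>2 \<mu>2t :: real
    assume *: "coeff_assms J L c \<beta>1 \<beta>4 \<beta>5 \<beta>6 \<mu>1 \<mu>2 \<mu>2t
      \<and> (CARD('n) = 2 \<and> a < 0 \<or> CARD('n) = 3) \<and> J < (\<lambda>_ _ _ _. 1) ((\<lambda>_ _ _. 1) a b c) a b c
      \<and> \<mu>1 > (\<lambda>_ _ _. 1) a b c \<and> \<beta>4 > (\<lambda>_ _ _ \<mu>2. \<mu>2\<^sup>2 / 2 + 1) \<mu>2t \<beta>5 \<beta>6 \<mu>2"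
    then show "apriori_bounds TYPE('n) J L a b c \<beta>1 \<beta>4 \<beta>5 \<beta>6 \<mu>1 \<mu>2 \<mu>2t"
      using weaker[of \<mu>1 \<mu>2] by (intro apriori_bounds_if_viscous) (auto simp: nondegenerate_def)
  qed (auto simp: add_nonneg_pos)
qed (use psiB_nonneg_dim2 psiB_negative_dim2 psiB_negative_dim3 in blast)+

end
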